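(* Let $1<q<p<\infty$, $\delta>0$, and let $g:\Omega\times\mathbb R^+\to\mathbb R$ be a Carathéodory function bounded from below such that $s\mapsto\frac{g(x,s)}{s^{q-1}}$ is nonincreasing on $\mathbb R^+$ for a.e. $x\in\Omega$. Let $u,v\in L^\infty(\Omega)\cap W^{1,p}_0(\Omega)$ be such that $u,v>0$ in $\Omega$, $\int_\Omega u^{1-\delta}dx<\infty$, $\int_\Omega v^{1-\delta}dx<\infty$, and, in the weak sense in $\Omega$, $$-\Delta_pu-\Delta_qu\le u^{-\delta}+g(x,u)\qquad\text{and}\qquad-\Delta_pv-\Delta_qv\ge v^{-\delta}+g(x,v).$$ Suppose furthermore that there exist a positive function $w\in L^\infty(\Omega)$ and constants $c_1,c_2>0$ such that $c_1w\le u,v\le c_2w$ with $$\int_\Omega|g(x,c_1w)|\,w\,dx<\infty\qquad\text{and}\qquad\int_\Omega|g(x,c_2w)|\,w\,dx<\infty.$$ Then $u\le v$ in $\Omega$.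
   Context: $\Omega\subset\mathbb R^N$ ($N\ge2$) is a bounded domain with $C^2$ boundary and $\Delta_pu=\nabla\cdot(|\nabla u|^{p-2}\nabla u)$. "$u>0$ in $\Omega$" means $\operatorname{ess\,inf}_Ku>0$ for every compact $K\subset\Omega$. Inequalities in the weak sense are tested against nonnegative $\phi\in C_c^\infty(\Omega)$, e.g. $\int_\Omega(|\nabla u|^{p-2}+|\nabla u|^{q-2})\nabla u\cdot\nabla\phi\,dx\le\int_\Omega(u^{-\delta}+g(x,u))\phi\,dx$. *)

theory Defs
  imports "HOL-Analysis.Analysis" "HOL-Probability.Essential_Supremum"
begin

primrec Ck :: "nat \<Rightarrow> ('a::euclidean_space \<Rightarrow> real) \<Rightarrow> bool" where
  "Ck 0 f \<longleftrightarrow> continuous_on UNIV f"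
| "Ck (Suc k) f \<longleftrightarrow>
     (\<exists>D. (\<forall>x. GDERIV f x :> D x) \<and> (\<forall>b\<in>Basis. Ck k (\<lambda>x. D x \<bullet> b)))"

definition grad :: "('a::euclidean_space \<Rightarrow> real) \<Rightarrow> 'a \<Rightarrow> 'a" where
  "grad f x = (THE D. GDERIV f x :> D)"

text \<open>Near each boundary point, \<open>\<Omega>\<close> is the region above the graph of a \<open>C\<^sup>2\<close> function in a
  rotated coordinate system with vertical axis \<open>e\<close>. Only the values of \<open>\<gamma>\<close> on the hyperplane
  orthogonal to \<open>e\<close> are used; a \<open>C\<^sup>2\<close> function on that hyperplane extends to the whole space
  by composition with the orthogonal projection.\<close>

definition C2_boundary :: "'a::euclidean_space set \<Rightarrow> bool" where
  "C2_boundary \<Omega> \<longleftrightarrow>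
     (\<forall>x0\<in>frontier \<Omega>. \<exists>r>0. \<exists>e \<gamma>. norm e = 1 \<and> Ck 2 \<gamma> \<and>
        \<Omega> \<inter> ball x0 r = {x \<in> ball x0 r. \<gamma> (x - (x \<bullet> e) *\<^sub>R e) < x \<bullet> e})"

definition test_functions :: "'a::euclidean_space set \<Rightarrow> ('a \<Rightarrow> real) set" where
  "test_functions \<Omega> =
     {\<phi>. (\<forall>k. Ck k \<phi>) \<and> compact (closure {x. \<phi> x \<noteq> 0}) \<and> closure {x. \<phi> x \<noteq> 0} \<subseteq> \<Omega>}"

text \<open>Elements of \<open>L\<^sup>p\<close> and Sobolev spaces are represented by functions on the whole
  space, of which only the values almost everywhere on \<open>\<Omega>\<close> matter.\<close>

definition Lp_space :: "real \<Rightarrow> 'a::euclidean_space set \<Rightarrow> ('a \<Rightarrow> 'b::euclidean_space) set" where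
  "Lp_space p \<Omega> = {f \<in> borel_measurable (lebesgue_on \<Omega>).
     integrable (lebesgue_on \<Omega>) (\<lambda>x. norm (f x) powr p)}"

definition Linf_space :: "'a::euclidean_space set \<Rightarrow> ('a \<Rightarrow> real) set" where
  "Linf_space \<Omega> = {f \<in> borel_measurable (lebesgue_on \<Omega>).
     esssup (lebesgue_on \<Omega>) (\<lambda>x. ereal \<bar>f x\<bar>) < \<infinity>}"

definition essinf :: "'a measure \<Rightarrow> ('a \<Rightarrow> real) \<Rightarrow> ereal" where
  "essinf M f = - esssup M (\<lambda>x. ereal (- f x))"

definition positive_in :: "'a::euclidean_space set \<Rightarrow> ('a \<Rightarrow> real) \<Rightarrow> bool" where
  "positive_in \<Omega> u \<longleftrightarrow> (\<forall>K. compact K \<and> K \<subseteq> \<Omega> \<longrightarrow> 0 < essinf (lebesgue_on K) u)"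

definition has_weak_gradient ::
    "'a::euclidean_space set \<Rightarrow> ('a \<Rightarrow> real) \<Rightarrow> ('a \<Rightarrow> 'a) \<Rightarrow> bool" where
  "has_weak_gradient \<Omega> u G \<longleftrightarrow>
     (\<forall>K. compact K \<and> K \<subseteq> \<Omega> \<longrightarrow> integrable (lebesgue_on K) u \<and> integrable (lebesgue_on K) G) \<and>
     (\<forall>\<phi>\<in>test_functions \<Omega>.
        (LINT x|lebesgue_on \<Omega>. u x *\<^sub>R grad \<phi> x) = - (LINT x|lebesgue_on \<Omega>. \<phi> x *\<^sub>R G x))"

text \<open>The weak gradient is unique up to null sets, so the choice below is immaterial.\<close>

definition weak_grad :: "'a::euclidean_space set \<Rightarrow> ('a \<Rightarrow> real) \<Rightarrow> 'a \<Rightarrow> 'a" where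
  "weak_grad \<Omega> u = (SOME G. has_weak_gradient \<Omega> u G)"

definition W1p :: "real \<Rightarrow> 'a::euclidean_space set \<Rightarrow> ('a \<Rightarrow> real) set" where
  "W1p p \<Omega> = {u \<in> Lp_space p \<Omega>.
     (\<exists>G. has_weak_gradient \<Omega> u G) \<and> weak_grad \<Omega> u \<in> Lp_space p \<Omega>}"

text \<open>The closure of the test functions in the \<open>W\<^sup>1\<^sup>,\<^sup>p\<close> norm.\<close>

definition W01p :: "real \<Rightarrow> 'a::euclidean_space set \<Rightarrow> ('a \<Rightarrow> real) set" where
  "W01p p \<Omega> = {u \<in> W1p p \<Omega>. \<exists>\<phi>::nat \<Rightarrow> 'a \<Rightarrow> real. (\<forall>n. \<phi> n \<in> test_functions \<Omega>) \<and>
     (\<lambda>n. (LINT x|lebesgue_on \<Omega>. \<bar>u x - \<phi> n x\<bar> powr p) +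
          (LINT x|lebesgue_on \<Omega>. norm (weak_grad \<Omega> u x - grad (\<phi> n) x) powr p))
       \<longlonglongrightarrow> 0}"

definition caratheodory :: "'a::euclidean_space set \<Rightarrow> ('a \<Rightarrow> real \<Rightarrow> real) \<Rightarrow> bool" where
  "caratheodory \<Omega> g \<longleftrightarrow>
     (\<forall>s>0. (\<lambda>x. g x s) \<in> borel_measurable (lebesgue_on \<Omega>)) \<and>
     (AE x in lebesgue_on \<Omega>. continuous_on {0<..} (g x))"

definition pq_laplace_form ::
    "real \<Rightarrow> real \<Rightarrow> 'a::euclidean_space set \<Rightarrow> ('a \<Rightarrow> real) \<Rightarrow> ('a \<Rightarrow> real) \<Rightarrow> real" where
  "pq_laplace_form p q \<Omega> u \<phi> =
     (LINT x|lebesgue_on \<Omega>.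
        (norm (weak_grad \<Omega> u x) powr (p - 2) + norm (weak_grad \<Omega> u x) powr (q - 2)) *
        (weak_grad \<Omega> u x \<bullet> grad \<phi> x))"

text \<open>\<open>- \<Delta>\<^sub>p u - \<Delta>\<^sub>q u \<le> f\<close> and \<open>- \<Delta>\<^sub>p u - \<Delta>\<^sub>q u \<ge> f\<close> in the weak sense. The Bochner integral
  of a non-integrable function is 0, so these are meaningful for \<open>u \<in> W\<^sup>1\<^sup>,\<^sup>p\<close>, \<open>1 < q < p\<close>, on a
  bounded \<open>\<Omega>\<close> (which makes the form finite) and for \<open>f\<close> locally integrable in \<open>\<Omega>\<close>.\<close>

definition weak_pq_le ::
    "real \<Rightarrow> real \<Rightarrow> 'a::euclidean_space set \<Rightarrow> ('a \<Rightarrow> real) \<Rightarrow> ('a \<Rightarrow> real) \<Rightarrow> bool" where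
  "weak_pq_le p q \<Omega> u f \<longleftrightarrow>
     (\<forall>\<phi>\<in>test_functions \<Omega>. (\<forall>x. 0 \<le> \<phi> x) \<longrightarrow>
        pq_laplace_form p q \<Omega> u \<phi> \<le> (LINT x|lebesgue_on \<Omega>. f x * \<phi> x))"

definition weak_pq_ge ::
    "real \<Rightarrow> real \<Rightarrow> 'a::euclidean_space set \<Rightarrow> ('a \<Rightarrow> real) \<Rightarrow> ('a \<Rightarrow> real) \<Rightarrow> bool" where
  "weak_pq_ge p q \<Omega> u f \<longleftrightarrow>
     (\<forall>\<phi>\<in>test_functions \<Omega>. (\<forall>x. 0 \<le> \<phi> x) \<longrightarrow>
        pq_laplace_form p q \<Omega> u \<phi> \<ge> (LINT x|lebesgue_on \<Omega>. f x * \<phi> x))"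

end

theory Submission
  imports Defs
begin

text \<open>
  The operator \<open>-\<Delta>\<^sub>p - \<Delta>\<^sub>q\<close> hides a convexity: for \<open>q \<le> r\<close> the energy \<open>\<integral> |\<nabla> (W powr (1/q))| powr r\<close> is
  convex in \<open>W\<close>. Put \<open>U = u + \<epsilon>\<close> and \<open>V = v + \<epsilon>\<close>, test the inequality for \<open>u\<close> with
  \<open>(U\<^sup>q - V\<^sup>q)\<^sup>+ / U powr (q - 1)\<close> and the one for \<open>v\<close> with \<open>(U\<^sup>q - V\<^sup>q)\<^sup>+ / V powr (q - 1)\<close>, and
  subtract. The convexity, in the pointwise form \<open>diaz_saa\<close>, makes the difference of the left-hand
  sides nonnegative. As \<open>\<epsilon> \<rightarrow> 0\<close> the difference of the right-hand sides tends to
  \<open>\<integral> (f\<^sub>u / u powr (q - 1) - f\<^sub>v / v powr (q - 1)) (u\<^sup>q - v\<^sup>q)\<^sup>+\<close>, where \<open>f\<^sub>u\<close> and \<open>f\<^sub>v\<close> are the reaction terms.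
  Since \<open>s \<mapsto> (s powr (-\<delta>) + g x s) / s powr (q - 1)\<close> is strictly decreasing, this integrand is negative
  wherever \<open>u > v\<close>; its integral being nonnegative, that set is null.

  The two test functions are neither smooth nor compactly supported. Instead of mollifying them, the
  proof composes smooth scalar functions with the test functions \<open>un n\<close> and \<open>vn n\<close> that approximate
  \<open>u\<close> and \<open>v\<close> in the Sobolev norm: the positive part becomes
  \<open>(z + sqrt (z\<^sup>2 + \<eta>\<^sup>2)) / 2\<close>, the restriction of the arguments to a bounded interval combines two such
  square roots, and the factor \<open>r\<^sup>2 / (r\<^sup>2 + \<sigma>\<^sup>2)\<close> at \<open>r = un m\<close> supplies the compact support.
  All of them are built from polynomials and powers of positive functions, so smoothness is a matter of closure rules.
  Then \<open>n \<rightarrow> \<infinity>\<close>, \<open>\<eta> \<rightarrow> 0\<close>, \<open>m \<rightarrow> \<infinity>\<close>, \<open>\<sigma> \<rightarrow> 0\<close> in this order (\<open>weak_inequality_ds_test\<close>).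

  Every limit is one of dominated convergence. Gradients are dominated by a single function in \<open>L\<^sup>p\<close>,
  because the approximations can be chosen to converge so fast that their errors are summable
  (\<open>W01p_dominated_approx\<close>). Reaction terms are dominated because, from \<open>\<eta> = 0\<close> on, the test functions are at most a multiple of \<open>u\<close>, and
  \<open>f\<^sub>u u\<close> and \<open>f\<^sub>v u\<close> are integrable: monotonicity of the quotient bounds \<open>g\<close> at \<open>u\<close> and \<open>v\<close>
  by its values at \<open>c1 w\<close> and \<open>c2 w\<close> (\<open>singular_reaction_integrable\<close>).
\<close>

section \<open>Smooth functions and their gradients\<close>

abbreviation smooth :: "('a::euclidean_space \<Rightarrow> real) \<Rightarrow> bool" where
  "smooth f \<equiv> \<forall>k. Ck k f"

lemma grad_eq: "GDERIV f x :> D \<Longrightarrow> grad f x = D"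
  unfolding grad_def gderiv_def
  by (metis (mono_tags, lifting) has_derivative_unique inner_commute the_equality vector_eq_rdot)

lemma GDERIV_grad:
  assumes "smooth f" shows "GDERIV f x :> grad f x"
proof -
  have "Ck (Suc 0) f" using assms by blast
  then obtain D where "GDERIV f x :> D x" by auto
  then show ?thesis using grad_eq by metis
qed

lemma smooth_grad: 
  assumes "smooth f" "b \<in> Basis" shows "smooth (\<lambda>x. grad f x \<bullet> b)"
proof
  fix k
  have "Ck (Suc k) f" using assms by blast
  then obtain D where D: "\<forall>x. GDERIV f x :> D x" "\<forall>b\<in>Basis. Ck k (\<lambda>x. D x \<bullet> b)" by auto
  then have "grad f = D" using grad_eq by blast
  with D assms show "Ck k (\<lambda>x. grad f x \<bullet> b)" by auto
qed

lemma Ck_Suc_D: "Ck (Suc k) f \<Longrightarrow> Ck k f"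
proof (induction k arbitrary: f)
  case 0
  then obtain D where "\<And>x. GDERIV f x :> D x" by auto
  then show ?case
    by (auto simp: gderiv_def intro!: continuous_at_imp_continuous_on has_derivative_continuous)
next
  case (Suc k)
  then obtain D where D: "\<forall>x. GDERIV f x :> D x" "\<forall>b\<in>Basis. Ck (Suc k) (\<lambda>x. D x \<bullet> b)"
    by (metis Ck.simps(2))
  then show ?case using Suc.IH by (metis Ck.simps(2))
qed

lemma Ck_const: "Ck k (\<lambda>x. c)"
proof (induction k arbitrary: c)
  case (Suc k)
  show ?case unfolding Ck.simps
    by (rule exI[where x="\<lambda>x. 0"]) (auto simp: GDERIV_const Suc)
qed auto

lemma Ck_add: "Ck k f \<Longrightarrow> Ck k g \<Longrightarrow> Ck k (\<lambda>x. f x + g x)"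
proof (induction k arbitrary: f g)
  case 0 then show ?case by (auto intro: continuous_on_add)
next
  case (Suc k)
  from Suc.prems obtain D E where
    "\<forall>x. GDERIV f x :> D x" "\<forall>b\<in>Basis. Ck k (\<lambda>x. D x \<bullet> b)"
    "\<forall>x. GDERIV g x :> E x" "\<forall>b\<in>Basis. Ck k (\<lambda>x. E x \<bullet> b)" by auto
  then show ?case unfolding Ck.simps
    by (intro exI[where x="\<lambda>x. D x + E x"]) (auto intro: GDERIV_add simp: inner_add_left Suc.IH)
qed

lemma Ck_mult: "Ck k f \<Longrightarrow> Ck k g \<Longrightarrow> Ck k (\<lambda>x. f x * g x)"
proof (induction k arbitrary: f g)
  case 0 then show ?case by (auto intro: continuous_on_mult)
next
  case (Suc k)
  from Suc.prems obtain D E where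
    "\<forall>x. GDERIV f x :> D x" "\<forall>b\<in>Basis. Ck k (\<lambda>x. D x \<bullet> b)"
    "\<forall>x. GDERIV g x :> E x" "\<forall>b\<in>Basis. Ck k (\<lambda>x. E x \<bullet> b)" by auto
  moreover have "Ck k f" "Ck k g" using Suc.prems Ck_Suc_D by blast+
  ultimately show ?case unfolding Ck.simps
    by (intro exI[where x="\<lambda>x. f x *\<^sub>R E x + g x *\<^sub>R D x"])
      (auto intro!: GDERIV_mult Ck_add simp: inner_add_left Suc.IH)
qed

lemma GDERIV_powr:
  assumes "GDERIV f x :> D" "f x > 0"
  shows "GDERIV (\<lambda>x. f x powr a) x :> (a * f x powr (a - 1)) *\<^sub>R D"
  by (rule GDERIV_DERIV_compose[OF assms(1)])
     (use assms(2) in \<open>auto intro!: derivative_eq_intros\<close>)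

text \<open>Induction over all exponents at once: differentiating lowers the exponent.\<close>

lemma Ck_powr: "Ck k f \<Longrightarrow> (\<And>x. f x > 0) \<Longrightarrow> Ck k (\<lambda>x. f x powr a)"
proof (induction k arbitrary: a)
  case 0 
  then have "f x \<noteq> 0" for x by (metis less_irrefl)
  then show ?case using 0 by (auto intro!: continuous_intros)
next
  case (Suc k)
  from Suc.prems obtain D where
    "\<forall>x. GDERIV f x :> D x" "\<forall>b\<in>Basis. Ck k (\<lambda>x. D x \<bullet> b)" by auto
  moreover have "Ck k f" using Suc.prems Ck_Suc_D by blast
  ultimately show ?case unfolding Ck.simps using Suc.prems
    by (intro exI[where x="\<lambda>x. (a * f x powr (a - 1)) *\<^sub>R D x"])
      (auto intro!: GDERIV_powr Ck_mult Ck_const Suc.IH)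
qed

lemma smooth_const: "smooth (\<lambda>x. c)" by (simp add: Ck_const)
lemma smooth_add: "smooth f \<Longrightarrow> smooth g \<Longrightarrow> smooth (\<lambda>x. f x + g x)" by (simp add: Ck_add)
lemma smooth_mult: "smooth f \<Longrightarrow> smooth g \<Longrightarrow> smooth (\<lambda>x. f x * g x)" by (simp add: Ck_mult)
lemma smooth_diff: "smooth f \<Longrightarrow> smooth g \<Longrightarrow> smooth (\<lambda>x. f x - g x)" 
  using smooth_add[OF _ smooth_mult[OF smooth_const[of "-1"]], of f g] by simp
lemma smooth_power2: "smooth f \<Longrightarrow> smooth (\<lambda>x. (f x)\<^sup>2)" 
  using smooth_mult[of f f] by (simp add: power2_eq_square)
lemma smooth_powr: "smooth f \<Longrightarrow> (\<And>x. f x > 0) \<Longrightarrow> smooth (\<lambda>x. f x powr a)" by (simp add: Ck_powr)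
lemma smooth_divide_pos: 
  assumes "smooth f" "smooth g" "\<And>x. g x > 0" shows "smooth (\<lambda>x. f x / g x)"
proof -
  have "(\<lambda>x. f x * g x powr -1) = (\<lambda>x. f x / g x)"
    using assms(3) by (intro ext) (simp add: powr_minus_divide less_imp_le)
  then show ?thesis using smooth_mult[OF assms(1) smooth_powr[OF assms(2,3)], of "-1"] by simp
qed
lemma smooth_imp_continuous: "smooth f \<Longrightarrow> continuous_on UNIV f" 
  using Ck.simps(1) by metis

lemma smooth_grad_continuous:
  assumes "smooth f" shows "continuous_on UNIV (grad f)"
proof -
  have "continuous_on UNIV (\<lambda>x. \<Sum>b\<in>Basis. (grad f x \<bullet> b) *\<^sub>R b)"
    by (intro continuous_intros smooth_imp_continuous smooth_grad assms)
  then show ?thesis by (simp add: euclidean_representation)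
qed

section \<open>Smooth substitutes for absolute value, positive part, truncation and cutoff\<close>

text \<open>All functions of this section make sense at parameter \<open>0\<close>, where division by zero gives
  the convention that fits: \<open>soft_pos 0\<close> is the positive part, and its formal derivative \<open>soft_step 0\<close> is
  the Heaviside function with value \<open>1/2\<close> at \<open>0\<close>, which is also the limit of \<open>soft_step \<eta> 0\<close>.\<close>

definition soft_abs :: "real \<Rightarrow> real \<Rightarrow> real" where
  "soft_abs \<eta> z = sqrt (z\<^sup>2 + \<eta>\<^sup>2)"
definition soft_sgn :: "real \<Rightarrow> real \<Rightarrow> real" where
  "soft_sgn \<eta> z = z / soft_abs \<eta> z"
definition soft_pos :: "real \<Rightarrow> real \<Rightarrow> real" where
  "soft_pos \<eta> z = (z + soft_abs \<eta> z) / 2"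
definition soft_step :: "real \<Rightarrow> real \<Rightarrow> real" where
  "soft_step \<eta> z = (1 + soft_sgn \<eta> z) / 2"
text \<open>For \<open>\<eta> = 0\<close> this is the nearest point of the interval \<open>{0..R}\<close>, written as a combination of
  two absolute values.\<close>

definition soft_clamp :: "real \<Rightarrow> real \<Rightarrow> real \<Rightarrow> real" where
  "soft_clamp R \<eta> s = (R + soft_abs \<eta> s - soft_abs \<eta> (s - R)) / 2"
definition soft_clamp_deriv :: "real \<Rightarrow> real \<Rightarrow> real \<Rightarrow> real" where
  "soft_clamp_deriv R \<eta> s = (soft_sgn \<eta> s - soft_sgn \<eta> (s - R)) / 2"
definition cutoff :: "real \<Rightarrow> real \<Rightarrow> real" where
  "cutoff \<sigma> r = r\<^sup>2 / (r\<^sup>2 + \<sigma>\<^sup>2)"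
definition cutoff_deriv :: "real \<Rightarrow> real \<Rightarrow> real" where
  "cutoff_deriv \<sigma> r = 2 * r * \<sigma>\<^sup>2 / (r\<^sup>2 + \<sigma>\<^sup>2)\<^sup>2"

lemma soft_abs_0: "soft_abs 0 z = \<bar>z\<bar>" by (simp add: soft_abs_def)
lemma soft_abs_ge: "\<bar>z\<bar> \<le> soft_abs \<eta> z" by (simp add: soft_abs_def real_le_rsqrt)
lemma soft_abs_le: "0 \<le> \<eta> \<Longrightarrow> soft_abs \<eta> z \<le> \<bar>z\<bar> + \<eta>" 
  using real_sqrt_sum_squares_triangle_ineq[of z 0 0 \<eta>] by (simp add: soft_abs_def)
lemma soft_abs_pos: "\<eta> > 0 \<Longrightarrow> soft_abs \<eta> z > 0" 
  by (simp add: soft_abs_def add_nonneg_pos)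
lemma soft_abs_lipschitz: "\<bar>soft_abs \<eta> s - soft_abs \<eta> t\<bar> \<le> \<bar>s - t\<bar>"
proof -
  have "soft_abs \<eta> s \<le> soft_abs \<eta> t + \<bar>s - t\<bar>" for s t
    using real_sqrt_sum_squares_triangle_ineq[of t "s - t" \<eta> 0] by (simp add: soft_abs_def)
  from this[of s t] this[of t s] show ?thesis by linarith
qed
lemma abs_soft_sgn_le: "\<bar>soft_sgn \<eta> z\<bar> \<le> 1"
  using soft_abs_ge[of z \<eta>] by (cases "z = 0") (auto simp: soft_sgn_def divide_le_eq)

lemma DERIV_soft_abs: "\<eta> > 0 \<Longrightarrow> DERIV (soft_abs \<eta>) z :> soft_sgn \<eta> z"
proof -
  assume "\<eta> > 0"
  then have p: "z\<^sup>2 + \<eta>\<^sup>2 > 0" by (simp add: add_nonneg_pos)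
  then have "DERIV (\<lambda>z. sqrt (z\<^sup>2 + \<eta>\<^sup>2)) z :> soft_sgn \<eta> z"
    by (auto intro!: derivative_eq_intros simp: soft_sgn_def soft_abs_def field_simps)
  then show ?thesis by (simp add: soft_abs_def[abs_def])
qed

lemma smooth_soft_abs: "\<eta> > 0 \<Longrightarrow> smooth f \<Longrightarrow> smooth (\<lambda>x. soft_abs \<eta> (f x))"
proof -
  assume *: "\<eta> > 0" "smooth f"
  then have p: "(f x)\<^sup>2 + \<eta>\<^sup>2 > 0" for x by (simp add: add_nonneg_pos)
  have "smooth (\<lambda>x. ((f x)\<^sup>2 + \<eta>\<^sup>2) powr (1/2))"
    using * p by (intro smooth_powr smooth_add smooth_power2 smooth_const) auto
  moreover have "soft_abs \<eta> (f x) = ((f x)\<^sup>2 + \<eta>\<^sup>2) powr (1/2)" for x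
    using p[of x] by (simp add: soft_abs_def powr_half_sqrt)
  ultimately show ?thesis by simp
qed

lemma soft_pos_nonneg: "0 \<le> soft_pos \<eta> z" using soft_abs_ge[of z \<eta>] by (simp add: soft_pos_def)
lemma soft_pos_le: "0 \<le> \<eta> \<Longrightarrow> soft_pos \<eta> z \<le> \<bar>z\<bar> + \<eta>" 
  using soft_abs_le[of \<eta> z] by (simp add: soft_pos_def)
lemma soft_step_bounds: "0 \<le> soft_step \<eta> z" "soft_step \<eta> z \<le> 1" 
  using abs_soft_sgn_le[of \<eta> z] by (auto simp: soft_step_def)
lemma soft_pos_0: "soft_pos 0 z = max z 0" 
  by (simp add: soft_pos_def soft_abs_def)
text \<open>This identity also holds at the kink, so that the inequality \<open>diaz_saa\<close> needs no
  distinction between \<open>U > V\<close>, \<open>U = V\<close> and \<open>U < V\<close>: its two sides carry the common factor \<open>soft_step\<close>.\<close>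

lemma soft_pos_0_step: "soft_pos 0 z = soft_step 0 z * z" 
  by (simp add: soft_pos_def soft_step_def soft_sgn_def soft_abs_def abs_if)
lemma DERIV_soft_pos: "\<eta> > 0 \<Longrightarrow> DERIV (soft_pos \<eta>) z :> soft_step \<eta> z"
  unfolding soft_pos_def[abs_def] soft_step_def
  by (auto intro!: derivative_eq_intros DERIV_soft_abs)
lemma smooth_soft_pos: "\<eta> > 0 \<Longrightarrow> smooth f \<Longrightarrow> smooth (\<lambda>x. soft_pos \<eta> (f x))"
  unfolding soft_pos_def[abs_def] 
  by (intro smooth_divide_pos smooth_add smooth_soft_abs smooth_const) auto

lemma soft_clamp_bounds: "0 \<le> R \<Longrightarrow> 0 \<le> soft_clamp R \<eta> s" "0 \<le> R \<Longrightarrow> soft_clamp R \<eta> s \<le> R"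
  using soft_abs_lipschitz[of \<eta> s "s - R"] by (auto simp: soft_clamp_def)
lemma abs_soft_clamp_deriv_le: "\<bar>soft_clamp_deriv R \<eta> s\<bar> \<le> 1"
  using abs_soft_sgn_le[of \<eta> s] abs_soft_sgn_le[of \<eta> "s-R"] by (auto simp: soft_clamp_deriv_def)
lemma DERIV_soft_clamp: "\<eta> > 0 \<Longrightarrow> DERIV (soft_clamp R \<eta>) s :> soft_clamp_deriv R \<eta> s"
proof -
  assume e: "\<eta> > 0"
  have "((\<lambda>x. soft_abs \<eta> (x - R)) has_real_derivative soft_sgn \<eta> (s - R) * (1 - 0)) (at s)"
    by (rule DERIV_chain2[OF DERIV_soft_abs[OF e]]) (auto intro!: derivative_eq_intros)
  then show ?thesis
    unfolding soft_clamp_def[abs_def] soft_clamp_deriv_def using DERIV_soft_abs[OF e, of s]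
    by (auto intro!: derivative_eq_intros)
qed
lemma smooth_soft_clamp: "\<eta> > 0 \<Longrightarrow> smooth f \<Longrightarrow> smooth (\<lambda>x. soft_clamp R \<eta> (f x))"
  unfolding soft_clamp_def[abs_def] 
  by (intro smooth_divide_pos smooth_add smooth_diff smooth_soft_abs smooth_const) auto

lemma tendsto_soft_abs:
  "(f \<longlongrightarrow> a) F \<Longrightarrow> (e \<longlongrightarrow> \<eta>) F \<Longrightarrow> ((\<lambda>n. soft_abs (e n) (f n)) \<longlongrightarrow> soft_abs \<eta> a) F"
  unfolding soft_abs_def by (intro tendsto_intros)
lemma tendsto_soft_sgn:
  "(f \<longlongrightarrow> a) F \<Longrightarrow> (e \<longlongrightarrow> \<eta>) F \<Longrightarrow> soft_abs \<eta> a \<noteq> 0 \<Longrightarrow> ((\<lambda>n. soft_sgn (e n) (f n)) \<longlongrightarrow> soft_sgn \<eta> a) F"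
  unfolding soft_sgn_def by (intro tendsto_intros tendsto_soft_abs)
lemma tendsto_soft_pos:
  "(f \<longlongrightarrow> a) F \<Longrightarrow> (e \<longlongrightarrow> \<eta>) F \<Longrightarrow> ((\<lambda>n. soft_pos (e n) (f n)) \<longlongrightarrow> soft_pos \<eta> a) F"
  unfolding soft_pos_def by (intro tendsto_intros tendsto_soft_abs) auto
lemma tendsto_soft_step:
  "(f \<longlongrightarrow> a) F \<Longrightarrow> \<eta> > 0 \<Longrightarrow> ((\<lambda>n. soft_step \<eta> (f n)) \<longlongrightarrow> soft_step \<eta> a) F"
  unfolding soft_step_def using soft_abs_pos[of \<eta> a] by (intro tendsto_intros tendsto_soft_sgn) auto
lemma tendsto_soft_step_0:
  assumes "(e \<longlongrightarrow> 0) F" shows "((\<lambda>n. soft_step (e n) z) \<longlongrightarrow> soft_step 0 z) F"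
proof (cases "z = 0")
  case True then show ?thesis by (simp add: soft_step_def soft_sgn_def)
next
  case False then show ?thesis unfolding soft_step_def using assms
    by (intro tendsto_intros tendsto_soft_sgn) (auto simp: soft_abs_def)
qed
text \<open>Strictly inside the interval both absolute values are differentiated away from their kinks.\<close>

lemma tendsto_soft_clamp:
  assumes "(f \<longlongrightarrow> s) F" "(e \<longlongrightarrow> 0) F" "0 < s" "s < R"
  shows "((\<lambda>n. soft_clamp R (e n) (f n)) \<longlongrightarrow> s) F" "((\<lambda>n. soft_clamp_deriv R (e n) (f n)) \<longlongrightarrow> 1) F"
proof -
  have "((\<lambda>n. soft_clamp R (e n) (f n)) \<longlongrightarrow> (R + soft_abs 0 s - soft_abs 0 (s - R)) / 2) F"
    unfolding soft_clamp_def using assms by (intro tendsto_intros tendsto_soft_abs) auto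
  then show "((\<lambda>n. soft_clamp R (e n) (f n)) \<longlongrightarrow> s) F" using assms by (simp add: soft_abs_0)
  have "((\<lambda>n. soft_clamp_deriv R (e n) (f n)) \<longlongrightarrow> (soft_sgn 0 s - soft_sgn 0 (s - R)) / 2) F"
    unfolding soft_clamp_deriv_def using assms by (intro tendsto_intros tendsto_soft_sgn) (auto simp: soft_abs_0)
  then show "((\<lambda>n. soft_clamp_deriv R (e n) (f n)) \<longlongrightarrow> 1) F" using assms by (simp add: soft_abs_0 soft_sgn_def field_simps)
qed

lemma cutoff_bounds: "0 \<le> cutoff \<sigma> r" "cutoff \<sigma> r \<le> 1"
  by (auto simp: cutoff_def divide_le_eq not_sum_power2_lt_zero)
lemma cutoff_0: "cutoff \<sigma> 0 = 0" by (simp add: cutoff_def)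
lemma DERIV_cutoff: "\<sigma> > 0 \<Longrightarrow> DERIV (cutoff \<sigma>) r :> cutoff_deriv \<sigma> r"
proof -
  assume s: "\<sigma> > 0"
  then have "r\<^sup>2 + \<sigma>\<^sup>2 \<noteq> 0" by (simp add: add_nonneg_pos)
  then show ?thesis unfolding cutoff_def[abs_def] cutoff_deriv_def
    by (auto intro!: derivative_eq_intros simp: field_simps power2_eq_square)
qed
lemma smooth_cutoff: "\<sigma> > 0 \<Longrightarrow> smooth f \<Longrightarrow> smooth (\<lambda>x. cutoff \<sigma> (f x))"
  unfolding cutoff_def
  by (intro smooth_divide_pos smooth_add smooth_power2 smooth_const) (auto simp: add_nonneg_pos)
text \<open>This bound is uniform in \<open>\<sigma>\<close>: it lets the cutoff tend to \<open>1\<close> in products with functions that are at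
  most a multiple of \<open>r\<close>.\<close>

lemma cutoff_deriv_mult_le: "\<bar>r * cutoff_deriv \<sigma> r\<bar> \<le> 1"
proof -
  have "2 * r\<^sup>2 * \<sigma>\<^sup>2 \<le> (r\<^sup>2 + \<sigma>\<^sup>2)\<^sup>2" by (simp add: power2_sum)
  moreover have "r * cutoff_deriv \<sigma> r = 2 * r\<^sup>2 * \<sigma>\<^sup>2 / (r\<^sup>2 + \<sigma>\<^sup>2)\<^sup>2" 
    by (simp add: cutoff_deriv_def power2_eq_square)
  ultimately show ?thesis by (auto simp: divide_le_eq)
qed
lemma abs_cutoff_deriv_le: "\<sigma> > 0 \<Longrightarrow> \<bar>cutoff_deriv \<sigma> r\<bar> \<le> 1 / \<sigma>"
proof -
  assume s: "\<sigma> > 0"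
  then have p: "r\<^sup>2 + \<sigma>\<^sup>2 > 0" by (simp add: add_nonneg_pos)
  have "2 * \<bar>r\<bar> * \<sigma> \<le> r\<^sup>2 + \<sigma>\<^sup>2" using zero_le_power2[of "\<bar>r\<bar> - \<sigma>"] by (simp add: power2_diff)
  moreover have "\<sigma>\<^sup>2 \<le> r\<^sup>2 + \<sigma>\<^sup>2" by simp
  ultimately have "2 * \<bar>r\<bar> * \<sigma> * \<sigma>\<^sup>2 \<le> (r\<^sup>2 + \<sigma>\<^sup>2) * (r\<^sup>2 + \<sigma>\<^sup>2)" 
    using s by (intro mult_mono) auto
  then have "2 * \<bar>r\<bar> * \<sigma> * \<sigma>\<^sup>2 / (r\<^sup>2 + \<sigma>\<^sup>2)\<^sup>2 \<le> 1" using p by (simp add: divide_le_eq power2_eq_square)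
  then show ?thesis using s by (simp add: cutoff_deriv_def abs_mult field_simps)
qed
lemma tendsto_cutoff:
  assumes "(f \<longlongrightarrow> r) F" "(s \<longlongrightarrow> \<sigma>) F" "r\<^sup>2 + \<sigma>\<^sup>2 \<noteq> 0" 
  shows "((\<lambda>n. cutoff (s n) (f n)) \<longlongrightarrow> cutoff \<sigma> r) F" "((\<lambda>n. cutoff_deriv (s n) (f n)) \<longlongrightarrow> cutoff_deriv \<sigma> r) F"
  unfolding cutoff_def cutoff_deriv_def using assms by (intro tendsto_intros; simp)+

section \<open>The Diaz-Saa inequality\<close>

lemma young_powr:
  fixes q s t :: real
  assumes "1 < q" "0 \<le> s" "0 \<le> t"
  shows "q * s powr (q - 1) * t \<le> (q - 1) * s powr q + t powr q"
proof -
  have "s powr (q - 1) * t \<le> (s powr (q - 1)) powr (q / (q - 1)) / (q / (q - 1)) + t powr q / q"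
    using assms by (intro Youngs_inequality) (auto simp: field_simps)
  also have "(s powr (q - 1)) powr (q / (q - 1)) = s powr q"
    using assms by (simp add: powr_powr)
  finally have "q * (s powr (q - 1) * t) \<le> q * (s powr q / (q / (q - 1)) + t powr q / q)"
    using assms by (intro mult_left_mono) auto
  also have "\<dots> = (q - 1) * s powr q + t powr q"
    using assms by (simp add: field_simps)
  finally show ?thesis by (simp add: mult.assoc)
qed

lemma powr_diff_le:
  fixes q U V :: real
  assumes "1 < q" "0 < U" "0 < V"
  shows "U powr q - V powr q \<le> q * U powr (q - 1) * (U - V)"
proof -
  have "U powr q = U powr (q - 1) * U"
    using assms powr_add[of U "q - 1" 1] by simp
  then show ?thesis using young_powr[of q U V] assms by (simp add: algebra_simps)
qed

text \<open>Apply Young's inequality with exponent \<open>q\<close> to \<open>c x\<close> and \<open>y\<close>, and to \<open>y / c\<close> and \<open>x\<close>, and multiply by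
  \<open>x powr (r - q)\<close> and \<open>y powr (r - q)\<close>. What is left over is
  \<open>(x powr (r - q) - y powr (r - q)) (x\<^sup>q - y\<^sup>q)\<close>, a product of factors of equal sign. The sign of the
  leftover is where \<open>q \<le> r\<close> enters, and hence \<open>q < p\<close> in the theorem.\<close>

lemma diaz_saa_scalar:
  fixes q r c x y :: real
  assumes "1 < q" "q \<le> r" "0 < c" "0 \<le> x" "0 \<le> y"
  shows "q * c powr (q - 1) * (x powr (r - 1) * y) + q * c powr (1 - q) * (y powr (r - 1) * x)
    \<le> x powr r * (1 + (q - 1) * c powr q) + y powr r * (1 + (q - 1) * c powr (- q))"
proof (cases "x = 0 \<or> y = 0")
  case True
  then show ?thesis using assms by auto
next
  case False
  then have xy: "0 < x" "0 < y" using assms by auto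
  have split: "s powr (r - q) * s powr (q - 1) = s powr (r - 1)" "s powr (r - q) * s powr q = s powr r" 
    if "0 < s" for s :: real
    using that by (simp_all flip: powr_add)
  have T: "q * d powr (q - 1) * (s powr (r - 1) * t) \<le> s powr r * ((q - 1) * d powr q) + s powr (r - q) * t powr q"
    if "0 < s" "0 < t" "0 < d" for s t d :: real
  proof -
    have "s powr (r - q) * (q * (d * s) powr (q - 1) * t) \<le> s powr (r - q) * ((q - 1) * (d * s) powr q + t powr q)"
      using assms that by (intro mult_left_mono young_powr) auto
    then show ?thesis 
      by (simp add: split[OF that(1), symmetric] powr_mult that less_imp_le algebra_simps)
  qed
  have inv: "(1 / c) powr a = c powr (- a)" for a
    using assms by (simp add: powr_divide powr_minus_divide)
  have "0 \<le> (x powr (r - q) - y powr (r - q)) * (x powr q - y powr q)"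
  proof (cases "x \<le> y")
    case True
    then show ?thesis using assms xy by (intro mult_nonpos_nonpos) (auto intro!: powr_mono2)
  next
    case False
    then show ?thesis using assms xy by (intro mult_nonneg_nonneg) (auto intro!: powr_mono2)
  qed
  then have "x powr (r - q) * y powr q + y powr (r - q) * x powr q \<le> x powr r + y powr r"
    using split(2)[of x] split(2)[of y] xy by (simp add: algebra_simps)
  then show ?thesis
    using T[of x y c] T[of y x "1 / c"] assms xy by (simp add: inv algebra_simps)
qed

text \<open>The exponents \<open>a = 1 - q\<close>, \<open>b = 0\<close> give the test function for \<open>u\<close> and \<open>a = 0\<close>, \<open>b = 1 - q\<close> the one for \<open>v\<close>.
  For \<open>\<eta> = 0\<close> the function is only locally Lipschitz, and the two following definitions are its formal partial derivatives.\<close>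

definition ds_test :: "real \<Rightarrow> real \<Rightarrow> real \<Rightarrow> real \<Rightarrow> real \<Rightarrow> real \<Rightarrow> real" where
  "ds_test q a b \<eta> U V = U powr a * V powr b * soft_pos \<eta> (U powr q - V powr q)"

definition ds_test_dU :: "real \<Rightarrow> real \<Rightarrow> real \<Rightarrow> real \<Rightarrow> real \<Rightarrow> real \<Rightarrow> real" where
  "ds_test_dU q a b \<eta> U V =
     a * U powr (a - 1) * V powr b * soft_pos \<eta> (U powr q - V powr q) +
     U powr a * V powr b * (soft_step \<eta> (U powr q - V powr q) * (q * U powr (q - 1)))"

definition ds_test_dV :: "real \<Rightarrow> real \<Rightarrow> real \<Rightarrow> real \<Rightarrow> real \<Rightarrow> real \<Rightarrow> real" where
  "ds_test_dV q a b \<eta> U V =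
     b * U powr a * V powr (b - 1) * soft_pos \<eta> (U powr q - V powr q) -
     U powr a * V powr b * (soft_step \<eta> (U powr q - V powr q) * (q * V powr (q - 1)))"

lemma ds_test_nonneg: "0 \<le> ds_test q a b \<eta> U V"
  by (simp add: ds_test_def soft_pos_nonneg)

lemma smooth_ds_test:
  assumes "smooth f" "smooth g" "\<And>x. 0 < f x" "\<And>x. 0 < g x" "\<eta> > 0"
  shows "smooth (\<lambda>x. ds_test q a b \<eta> (f x) (g x))"
  unfolding ds_test_def
  by (intro smooth_mult smooth_powr smooth_soft_pos smooth_diff assms)

lemma GDERIV_ds_test:
  assumes f: "GDERIV f x :> D" and g: "GDERIV g x :> E" and pos: "0 < f x" "0 < g x" and "\<eta> > 0"
  shows "GDERIV (\<lambda>x. ds_test q a b \<eta> (f x) (g x)) x :>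
    ds_test_dU q a b \<eta> (f x) (g x) *\<^sub>R D + ds_test_dV q a b \<eta> (f x) (g x) *\<^sub>R E"
  unfolding ds_test_def
  by (rule GDERIV_subst[OF GDERIV_mult[OF GDERIV_mult[OF GDERIV_powr[OF f pos(1)] GDERIV_powr[OF g pos(2)]]
       GDERIV_DERIV_compose[OF GDERIV_diff[OF GDERIV_powr[OF f pos(1)] GDERIV_powr[OF g pos(2)]] 
         DERIV_soft_pos[OF \<open>\<eta> > 0\<close>]]]])
     (simp add: ds_test_dU_def ds_test_dV_def algebra_simps)

text \<open>The coefficients of \<open>X\<close> and \<open>Y\<close> are functions of the ratio \<open>c = V / U\<close> alone, up to the common factor
  \<open>soft_step\<close>; after the Cauchy-Schwarz inequality the scalar statement applies to the norms.\<close>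

lemma diaz_saa:
  fixes X Y :: "'a::real_inner"
  assumes q: "1 < q" "q \<le> r" and UV: "0 < U" "0 < V"
  shows "norm Y powr (r - 2) * (Y \<bullet> (ds_test_dU q 0 (1 - q) 0 U V *\<^sub>R X + ds_test_dV q 0 (1 - q) 0 U V *\<^sub>R Y))
       \<le> norm X powr (r - 2) * (X \<bullet> (ds_test_dU q (1 - q) 0 0 U V *\<^sub>R X + ds_test_dV q (1 - q) 0 0 U V *\<^sub>R Y))"
proof -
  define s where "s = soft_step 0 (U powr q - V powr q)"
  define c where "c = V / U"
  have s: "0 \<le> s" and c: "0 < c" using UV soft_step_bounds by (auto simp: s_def c_def)
  have e: "W powr (- q) * W powr q = 1" "W powr (1 - q) * W powr (q - 1) = 1" if "0 < W" for W
    using that by (simp_all flip: powr_add)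
  have c1: "c powr k = V powr k * U powr (- k)" for k
    using UV by (simp add: c_def powr_divide powr_minus_divide)
  have A1: "ds_test_dU q (1 - q) 0 0 U V = s * (1 + (q - 1) * c powr q)"
  proof -
    have "ds_test_dU q (1 - q) 0 0 U V = s * ((1 - q) * (U powr (- q) * U powr q) - (1 - q) * (V powr q * U powr (- q)) + q * (U powr (1 - q) * U powr (q - 1)))"
      using UV by (simp add: ds_test_dU_def soft_pos_0_step s_def algebra_simps)
    then show ?thesis unfolding e[OF UV(1)] c1 by (simp add: algebra_simps)
  qed
  have A2: "ds_test_dV q (1 - q) 0 0 U V = - s * (q * c powr (q - 1))"
    using UV by (simp add: ds_test_dV_def s_def c1)
  have B1: "ds_test_dU q 0 (1 - q) 0 U V = s * (q * c powr (1 - q))"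
    using UV by (simp add: ds_test_dU_def s_def c1)
  have B2: "ds_test_dV q 0 (1 - q) 0 U V = - s * (1 + (q - 1) * c powr (- q))"
  proof -
    have "ds_test_dV q 0 (1 - q) 0 U V = - s * ((1 - q) * (V powr (- q) * V powr q) - (1 - q) * (V powr (- q) * U powr q) + q * (V powr (1 - q) * V powr (q - 1)))"
      using UV by (simp add: ds_test_dV_def soft_pos_0_step s_def algebra_simps)
    then show ?thesis unfolding e[OF UV(2)] c1 by (simp add: algebra_simps)
  qed
  have sq: "norm Z powr (r - 2) * (Z \<bullet> Z) = norm Z powr r" for Z :: 'a
    by (cases "Z = 0") (auto simp: dot_square_norm simp flip: powr_numeral powr_add)
  have cr: "norm Z powr (r - 2) * (Z \<bullet> W) \<le> norm Z powr (r - 1) * norm W" for Z W :: 'a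
  proof -
    have "norm Z powr (r - 2) * (Z \<bullet> W) \<le> norm Z powr (r - 2) * (norm Z * norm W)"
      by (intro mult_left_mono norm_cauchy_schwarz) auto
    also have "\<dots> = norm Z powr (r - 1) * norm W"
    proof (cases "Z = 0")
      case False
      then have "norm Z powr (r - 1) = norm Z powr (r - 2) * norm Z"
        using powr_add[of "norm Z" "r - 2" 1] by simp
      then show ?thesis by simp
    qed simp
    finally show ?thesis .
  qed
  have "q * c powr (q - 1) * (norm X powr (r - 2) * (X \<bullet> Y)) \<le> q * c powr (q - 1) * (norm X powr (r - 1) * norm Y)"
    "q * c powr (1 - q) * (norm Y powr (r - 2) * (Y \<bullet> X)) \<le> q * c powr (1 - q) * (norm Y powr (r - 1) * norm X)"
    using q by (intro mult_left_mono cr; simp)+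
  with diaz_saa_scalar[OF q c, of "norm X" "norm Y"]
  have "q * c powr (q - 1) * (norm X powr (r - 2) * (X \<bullet> Y)) + q * c powr (1 - q) * (norm Y powr (r - 2) * (Y \<bullet> X))
    \<le> norm X powr (r - 2) * (X \<bullet> X) * (1 + (q - 1) * c powr q) + norm Y powr (r - 2) * (Y \<bullet> Y) * (1 + (q - 1) * c powr (- q))"
    unfolding sq by simp
  then have "0 \<le> s * (norm X powr (r - 2) * (X \<bullet> X) * (1 + (q - 1) * c powr q) + norm Y powr (r - 2) * (Y \<bullet> Y) * (1 + (q - 1) * c powr (- q))
     - (q * c powr (q - 1) * (norm X powr (r - 2) * (X \<bullet> Y)) + q * c powr (1 - q) * (norm Y powr (r - 2) * (Y \<bullet> X))))"
    using s by (intro mult_nonneg_nonneg) auto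
  then show ?thesis
    unfolding A1 A2 B1 B2 inner_add_right inner_scaleR_right
    by (simp add: algebra_simps)
qed

lemma powr_le_sum_endpoints:
  fixes U \<epsilon> R k :: real
  assumes "0 < \<epsilon>" "\<epsilon> \<le> U" "U \<le> R"
  shows "U powr k \<le> \<epsilon> powr k + R powr k"
proof -
  have "U powr k \<le> \<epsilon> powr k \<or> U powr k \<le> R powr k"
    using assms by (cases "0 \<le> k") (auto intro: powr_mono2 powr_mono2')
  then show ?thesis by (smt (verit) powr_ge_zero)
qed

text \<open>One constant serves all \<open>\<eta>\<close> including \<open>0\<close>, hence all the limits below.\<close>

lemma ds_test_box_bound:
  assumes "0 < \<epsilon>"
  obtains B where "0 \<le> B" 
    "\<And>\<eta> U V. \<lbrakk>0 \<le> \<eta>; \<eta> \<le> 1; \<epsilon> \<le> U; U \<le> R; \<epsilon> \<le> V; V \<le> R\<rbrakk> \<Longrightarrow>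
       \<bar>ds_test q a b \<eta> U V\<bar> \<le> B \<and> \<bar>ds_test_dU q a b \<eta> U V\<bar> \<le> B \<and> \<bar>ds_test_dV q a b \<eta> U V\<bar> \<le> B"
proof -
  define Q where "Q k = \<epsilon> powr k + R powr k" for k :: real
  have Q: "U powr k \<le> Q k" "0 \<le> Q k" if "\<epsilon> \<le> U" "U \<le> R" for U k
    using powr_le_sum_endpoints[OF assms that] by (simp_all add: Q_def)
  define S where "S = Q q + 1"
  define B1 where "B1 = Q a * Q b * S"
  define B2 where "B2 = \<bar>a\<bar> * Q (a - 1) * Q b * S"
  define B3 where "B3 = Q a * Q b * (1 * (\<bar>q\<bar> * Q (q - 1)))"
  define B4 where "B4 = \<bar>b\<bar> * Q a * Q (b - 1) * S"
  define B where "B = B1 + (B2 + B3) + (B4 + B3)"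
  show ?thesis
  proof (rule that[of B])
    have Q0: "0 \<le> Q k" for k by (simp add: Q_def)
    then have S0: "0 \<le> S" by (simp add: S_def)
    have nn: "0 \<le> B1" "0 \<le> B2" "0 \<le> B3" "0 \<le> B4"
      unfolding B1_def B2_def B3_def B4_def using Q0 S0 by (intro mult_nonneg_nonneg; simp)+
    then show "0 \<le> B" by (simp add: B_def)
    fix \<eta> U V :: real assume *: "0 \<le> \<eta>" "\<eta> \<le> 1" "\<epsilon> \<le> U" "U \<le> R" "\<epsilon> \<le> V" "V \<le> R"
    define P where "P = soft_pos \<eta> (U powr q - V powr q)"
    define d where "d = soft_step \<eta> (U powr q - V powr q)"
    have "P \<le> \<bar>U powr q - V powr q\<bar> + \<eta>" unfolding P_def by (rule soft_pos_le) (use * in auto)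
    also have "\<dots> \<le> S" unfolding S_def using * Q(1)[of U q] Q(1)[of V q] powr_ge_zero[of U q] powr_ge_zero[of V q] 
      by linarith
    finally have P: "P \<le> S" "0 \<le> P" by (auto simp: P_def soft_pos_nonneg)
    have d: "0 \<le> d" "d \<le> 1" unfolding d_def by (rule soft_step_bounds)+
    note QU = Q[OF *(3,4)] and QV = Q[OF *(5,6)]
    have 1: "U powr a * V powr b * P \<le> B1" unfolding B1_def
      using P by (intro mult_mono QU QV mult_nonneg_nonneg) auto
    have 2: "\<bar>a * U powr (a - 1) * V powr b * P\<bar> \<le> B2"
      unfolding B2_def abs_mult using P S0 Q0 by (intro mult_mono mult_nonneg_nonneg QU QV order_refl abs_ge_zero; simp add: QU QV)
    have 3: "\<bar>U powr a * V powr b * (d * (q * U powr (q - 1)))\<bar> \<le> B3"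
      unfolding B3_def abs_mult using d Q0 by (intro mult_mono mult_nonneg_nonneg QU QV order_refl abs_ge_zero; simp add: QU QV)
    have 4: "\<bar>b * U powr a * V powr (b - 1) * P\<bar> \<le> B4"
      unfolding B4_def abs_mult using P S0 Q0 by (intro mult_mono mult_nonneg_nonneg QU QV order_refl abs_ge_zero; simp add: QU QV)
    have 5: "\<bar>U powr a * V powr b * (d * (q * V powr (q - 1)))\<bar> \<le> B3"
      unfolding B3_def abs_mult using d Q0 by (intro mult_mono mult_nonneg_nonneg QU QV order_refl abs_ge_zero; simp add: QU QV)
    have 0: "0 \<le> U powr a * V powr b * P" using P by (intro mult_nonneg_nonneg) auto
    have sum: "\<bar>x + y\<bar> \<le> X + Y" "\<bar>x - y\<bar> \<le> X + Y" if "\<bar>x\<bar> \<le> X" "\<bar>y\<bar> \<le> Y" for x y X Y :: real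
      using that by auto
    have "\<bar>ds_test q a b \<eta> U V\<bar> \<le> B"
      unfolding ds_test_def P_def[symmetric] B_def using 0 1 nn by linarith
    moreover have "\<bar>ds_test_dU q a b \<eta> U V\<bar> \<le> B"
      unfolding ds_test_dU_def P_def[symmetric] d_def[symmetric] 
      using sum(1)[OF 2 3] nn unfolding B_def by linarith
    moreover have "\<bar>ds_test_dV q a b \<eta> U V\<bar> \<le> B"
      unfolding ds_test_dV_def P_def[symmetric] d_def[symmetric] 
      using sum(2)[OF 4 5] nn unfolding B_def by linarith
    ultimately show "\<bar>ds_test q a b \<eta> U V\<bar> \<le> B \<and> \<bar>ds_test_dU q a b \<eta> U V\<bar> \<le> B \<and> \<bar>ds_test_dV q a b \<eta> U V\<bar> \<le> B"
      by blast
  qed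
qed

text \<open>Convexity of \<open>t \<mapsto> t\<^sup>q\<close> bounds \<open>U\<^sup>q - V\<^sup>q\<close> by its tangent at \<open>U\<close>. Shifts of \<open>U\<close> and \<open>V\<close> by the same
  \<open>\<epsilon>\<close> cancel in \<open>U - V\<close>, so the test functions are at most a multiple of \<open>u\<close>.\<close>

lemma ds_test_le_diff:
  assumes "1 < q" "0 < U" "0 < V"
  shows "ds_test q a b 0 U V \<le> U powr a * V powr b * (q * U powr (q - 1)) * max (U - V) 0"
proof (cases "V < U")
  case True
  then have "V powr q \<le> U powr q" using assms by (intro powr_mono2) auto
  then have "ds_test q a b 0 U V = U powr a * V powr b * (U powr q - V powr q)"
    by (simp add: ds_test_def soft_pos_0)
  also have "\<dots> \<le> U powr a * V powr b * (q * U powr (q - 1) * (U - V))"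
    using assms by (intro mult_left_mono powr_diff_le) auto
  finally show ?thesis using True by (simp add: mult.assoc)
next
  case False
  then have "U powr q \<le> V powr q" using assms by (intro powr_mono2) auto
  then show ?thesis using False assms by (simp add: ds_test_def soft_pos_0)
qed

section \<open>Dominated approximation in Sobolev spaces\<close>

text \<open>Choose indices with integrals at most \<open>(1/2)\<^sup>n\<close>. The sum of the chosen functions is
  integrable, it dominates each of them, and it converges almost everywhere, so its terms tend to \<open>0\<close>.\<close>

lemma L1_null_dominated_subseq:
  fixes F :: "nat \<Rightarrow> 'a \<Rightarrow> real"
  assumes int: "\<And>n. integrable M (F n)" and nonneg: "\<And>n x. 0 \<le> F n x"
    and lim: "(\<lambda>n. LINT x|M. F n x) \<longlonglongrightarrow> 0"
  obtains r :: "nat \<Rightarrow> nat" and S where "integrable M S" "\<And>x. 0 \<le> S x"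
    "AE x in M. (\<forall>n. F (r n) x \<le> S x) \<and> (\<lambda>n. F (r n) x) \<longlonglongrightarrow> 0"
proof -
  have "\<exists>k. (LINT x|M. F k x) \<le> (1/2) ^ n" for n
  proof -
    have "eventually (\<lambda>k. (LINT x|M. F k x) < (1/2) ^ n) sequentially"
      using lim by (rule order_tendstoD) simp
    then show ?thesis by (metis (mono_tags, lifting) eventually_sequentially less_imp_le order_refl)
  qed
  then obtain r where r: "\<And>n. (LINT x|M. F (r n) x) \<le> (1/2) ^ n" by metis
  note [measurable] = borel_measurable_integrable[OF int]
  have "(\<integral>\<^sup>+ x. (\<Sum>n. ennreal (F (r n) x)) \<partial>M) = (\<Sum>n. \<integral>\<^sup>+ x. ennreal (F (r n) x) \<partial>M)"
    by (rule nn_integral_suminf) measurable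
  also have "\<dots> \<le> (\<Sum>n. ennreal ((1/2) ^ n))"
  proof (rule suminf_le)
    fix n
    have "(\<integral>\<^sup>+ x. ennreal (F (r n) x) \<partial>M) = ennreal (LINT x|M. F (r n) x)"
      using int nonneg by (intro nn_integral_eq_integral) auto
    then show "(\<integral>\<^sup>+ x. ennreal (F (r n) x) \<partial>M) \<le> ennreal ((1/2) ^ n)"
      using r by (simp add: ennreal_leI)
  qed auto
  also have "\<dots> = ennreal (\<Sum>n. (1/2) ^ n)" by (rule suminf_ennreal2) (auto intro: summable_geometric)
  also have "\<dots> < \<infinity>" by simp
  finally have "AE x in M. (\<Sum>n. ennreal (F (r n) x)) \<noteq> \<infinity>"
    by (intro nn_integral_PInf_AE) auto
  then have summable: "AE x in M. summable (\<lambda>n. F (r n) x)"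
    by eventually_elim (auto intro!: summable_suminf_not_top nonneg)
  have "integrable M (\<lambda>x. \<Sum>n. F (r n) x)"
  proof (rule integrable_suminf)
    show "AE x in M. summable (\<lambda>n. norm (F (r n) x))" using summable nonneg by simp
    have "summable (\<lambda>n. (LINT x|M. F (r n) x))"
      by (rule summable_comparison_test'[where g="\<lambda>n. (1/2) ^ n" and N=0]) 
         (use r nonneg in \<open>auto simp: summable_geometric\<close>)
    then show "summable (\<lambda>n. LINT x|M. norm (F (r n) x))" using nonneg by simp
  qed (rule int)
  then show ?thesis
  proof (rule that[OF integrable_abs])
    show "AE x in M. (\<forall>n. F (r n) x \<le> \<bar>\<Sum>n. F (r n) x\<bar>) \<and> (\<lambda>n. F (r n) x) \<longlonglongrightarrow> 0"
      using summable
    proof eventually_elim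
      case (elim x)
      have "F (r n) x \<le> (\<Sum>n. F (r n) x)" for n
        using sum_le_suminf[OF elim, of "{n}"] nonneg by simp
      then show ?case using summable_LIMSEQ_zero[OF elim] by (auto intro: order_trans[OF _ abs_ge_self])
    qed
  qed simp
qed

lemma powr_add_le:
  fixes a b p :: real
  assumes "0 \<le> a" "0 \<le> b" "0 \<le> p"
  shows "(a + b) powr p \<le> 2 powr p * (a powr p + b powr p)"
proof -
  have "(a + b) powr p \<le> (2 * max a b) powr p" using assms by (intro powr_mono2) auto
  also have "\<dots> = 2 powr p * max a b powr p" using assms by (simp add: powr_mult)
  also have "\<dots> \<le> 2 powr p * (a powr p + b powr p)"
    by (intro mult_left_mono) (auto simp: max_def)
  finally show ?thesis .
qed

lemma Lp_space_add:
  assumes "0 \<le> p" "f \<in> Lp_space p \<Omega>" "g \<in> Lp_space p \<Omega>"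
  shows "(\<lambda>x. f x + g x) \<in> Lp_space p \<Omega>"
proof -
  have [measurable]: "f \<in> borel_measurable (lebesgue_on \<Omega>)" "g \<in> borel_measurable (lebesgue_on \<Omega>)"
    using assms by (auto simp: Lp_space_def)
  have "integrable (lebesgue_on \<Omega>) (\<lambda>x. norm (f x + g x) powr p)"
  proof (rule Bochner_Integration.integrable_bound)
    show "integrable (lebesgue_on \<Omega>) (\<lambda>x. 2 powr p * (norm (f x) powr p + norm (g x) powr p))"
      using assms by (intro integrable_mult_right Bochner_Integration.integrable_add) (auto simp: Lp_space_def)
    show "AE x in lebesgue_on \<Omega>. norm (norm (f x + g x) powr p) \<le> norm (2 powr p * (norm (f x) powr p + norm (g x) powr p))"
    proof (rule AE_I2)
      fix x
      have "norm (f x + g x) powr p \<le> (norm (f x) + norm (g x)) powr p"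
        using assms by (intro powr_mono2 norm_triangle_ineq) auto
      also have "\<dots> \<le> 2 powr p * (norm (f x) powr p + norm (g x) powr p)"
        using assms by (intro powr_add_le) auto
      finally show "norm (norm (f x + g x) powr p) \<le> norm (2 powr p * (norm (f x) powr p + norm (g x) powr p))"
        by simp
    qed
  qed measurable
  then show ?thesis by (simp add: Lp_space_def)
qed

lemma Lp_space_diff:
  assumes "0 \<le> p" "f \<in> Lp_space p \<Omega>" "g \<in> Lp_space p \<Omega>"
  shows "(\<lambda>x. f x - g x) \<in> Lp_space p \<Omega>"
  using Lp_space_add[OF assms(1,2), of "\<lambda>x. - g x"] assms(3) by (simp add: Lp_space_def)

lemma finite_measure_lebesgue_on_bounded:
  "open \<Omega> \<Longrightarrow> bounded \<Omega> \<Longrightarrow> finite_measure (lebesgue_on \<Omega>)"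
  by (intro finite_measure_lebesgue_on lmeasurable_open)

lemma continuous_bounded_Lp_space:
  assumes "open \<Omega>" "bounded \<Omega>" "continuous_on UNIV f" "\<And>x. norm (f x) \<le> B" "0 \<le> p"
  shows "f \<in> Lp_space p \<Omega>"
proof -
  interpret finite_measure "lebesgue_on \<Omega>" using assms finite_measure_lebesgue_on_bounded by blast
  have [measurable]: "f \<in> borel_measurable (lebesgue_on \<Omega>)"
    using assms by (intro continuous_imp_measurable_on_sets_lebesgue) (auto intro: continuous_on_subset)
  have "integrable (lebesgue_on \<Omega>) (\<lambda>x. norm (f x) powr p)"
  proof (rule integrable_const_bound)
    show "AE x in lebesgue_on \<Omega>. norm (norm (f x) powr p) \<le> B powr p"
      using assms by (auto intro!: powr_mono2)
  qed measurable
  then show ?thesis by (simp add: Lp_space_def)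
qed

lemma compact_support_bounded:
  fixes f :: "'a::euclidean_space \<Rightarrow> 'b::real_normed_vector"
  assumes "continuous_on UNIV f" "compact K" "\<And>x. x \<notin> K \<Longrightarrow> f x = 0"
  obtains B where "\<And>x. norm (f x) \<le> B"
proof -
  have "bounded (f ` K)" using assms by (intro compact_imp_bounded compact_continuous_image) (auto intro: continuous_on_subset)
  then obtain B where B: "\<And>x. x \<in> K \<Longrightarrow> norm (f x) \<le> B" unfolding bounded_iff by blast
  then have "norm (f x) \<le> max B 0" for x using assms(3)[of x] B[of x] by (cases "x \<in> K") (auto simp: le_max_iff_disj)
  then show ?thesis using that by blast
qed

lemma grad_eq_0_outside_support:
  assumes "x \<notin> closure {x. \<phi> x \<noteq> 0}"
  shows "grad \<phi> x = 0"
proof (rule grad_eq)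
  have "GDERIV (\<lambda>x. 0) x :> 0" by (rule GDERIV_const)
  then show "GDERIV \<phi> x :> 0"
    unfolding gderiv_def
  proof (rule has_derivative_transform_within_open)
    show "open (- closure {x. \<phi> x \<noteq> 0})" by (intro open_Compl closed_closure)
    show "y \<in> - closure {x. \<phi> x \<noteq> 0} \<Longrightarrow> 0 = \<phi> y" for y
      using subsetD[OF closure_subset[of "{x. \<phi> x \<noteq> 0}"], of y] by auto
  qed (use assms in auto)
qed

lemma test_function_Lp_space:
  assumes "open \<Omega>" "bounded \<Omega>" "0 \<le> p" "\<phi> \<in> test_functions \<Omega>"
  shows "\<phi> \<in> Lp_space p \<Omega>" "grad \<phi> \<in> Lp_space p \<Omega>"
proof -
  have sm: "smooth \<phi>" and K: "compact (closure {x. \<phi> x \<noteq> 0})" using assms(4) unfolding test_functions_def by blast+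
  have "x \<notin> closure {x. \<phi> x \<noteq> 0} \<Longrightarrow> \<phi> x = 0" for x 
    using subsetD[OF closure_subset[of "{x. \<phi> x \<noteq> 0}"], of x] by auto
  with compact_support_bounded[OF smooth_imp_continuous[OF sm] K] obtain B where "\<And>x. norm (\<phi> x) \<le> B" by metis
  then show "\<phi> \<in> Lp_space p \<Omega>" using assms sm by (intro continuous_bounded_Lp_space smooth_imp_continuous)
  from compact_support_bounded[OF smooth_grad_continuous[OF sm] K] obtain B where "\<And>x. norm (grad \<phi> x) \<le> B" 
    using grad_eq_0_outside_support by metis
  then show "grad \<phi> \<in> Lp_space p \<Omega>" using assms sm by (intro continuous_bounded_Lp_space smooth_grad_continuous)
qed

lemma powr_LIMSEQ_0_D:
  fixes f :: "nat \<Rightarrow> 'a::real_normed_vector"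
  assumes "0 < p" "(\<lambda>n. norm (f n - l) powr p) \<longlonglongrightarrow> 0"
  shows "f \<longlonglongrightarrow> l"
proof -
  have "(\<lambda>n. (norm (f n - l) powr p) powr (1/p)) \<longlonglongrightarrow> 0 powr (1/p)"
    using assms by (intro tendsto_powr2 tendsto_const) auto
  then have "(\<lambda>n. norm (f n - l)) \<longlonglongrightarrow> 0" using assms by (simp add: powr_powr)
  then show ?thesis by (simp add: LIM_zero_cancel tendsto_norm_zero_iff)
qed

text \<open>With \<open>S\<close> dominating the \<open>p\<close>-th powers of the errors, the dominating function is \<open>|\<nabla>u| + S powr (1/p)\<close>.\<close>

lemma W01p_dominated_approx:
  assumes "open \<Omega>" "bounded \<Omega>" "1 < p" "u \<in> W01p p \<Omega>"
  obtains \<phi> h where "\<And>n. \<phi> n \<in> test_functions \<Omega>" "h \<in> Lp_space p \<Omega>" "\<And>x. 0 \<le> h x"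
    "AE x in lebesgue_on \<Omega>. (\<lambda>n. \<phi> n x) \<longlonglongrightarrow> u x \<and> (\<lambda>n. grad (\<phi> n) x) \<longlonglongrightarrow> weak_grad \<Omega> u x \<and>
       norm (weak_grad \<Omega> u x) \<le> h x \<and> (\<forall>n. norm (grad (\<phi> n) x) \<le> h x)"
proof -
  let ?M = "lebesgue_on \<Omega>" and ?D = "weak_grad \<Omega> u"
  from assms obtain \<psi> where \<psi>: "\<And>n. \<psi> n \<in> test_functions \<Omega>"
    and lim: "(\<lambda>n. (LINT x|?M. \<bar>u x - \<psi> n x\<bar> powr p) + (LINT x|?M. norm (?D x - grad (\<psi> n) x) powr p)) \<longlonglongrightarrow> 0"
    and u: "u \<in> Lp_space p \<Omega>" and D: "?D \<in> Lp_space p \<Omega>"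
    by (auto simp: W01p_def W1p_def)
  define F where "F n x = \<bar>u x - \<psi> n x\<bar> powr p + norm (?D x - grad (\<psi> n) x) powr p" for n x
  have i1: "integrable ?M (\<lambda>x. \<bar>u x - \<psi> n x\<bar> powr p)" for n
    using Lp_space_diff[OF _ u test_function_Lp_space(1)[OF assms(1,2) _ \<psi>]] assms(3)
    by (simp add: Lp_space_def)
  have i2: "integrable ?M (\<lambda>x. norm (?D x - grad (\<psi> n) x) powr p)" for n
    using Lp_space_diff[OF _ D test_function_Lp_space(2)[OF assms(1,2) _ \<psi>]] assms(3)
    by (simp add: Lp_space_def)
  have "integrable ?M (F n)" for n using i1 i2 by (simp add: F_def[abs_def])
  moreover have "0 \<le> F n x" for n x by (simp add: F_def)
  moreover have "(\<lambda>n. LINT x|?M. F n x) \<longlonglongrightarrow> 0" using lim i1 i2 by (simp add: F_def)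
  ultimately obtain S r where S: "integrable ?M S" "\<And>x. 0 \<le> S x"
    and AE: "AE x in ?M. (\<forall>n. F (r n) x \<le> S x) \<and> (\<lambda>n. F (r n) x) \<longlonglongrightarrow> 0"
    by (rule L1_null_dominated_subseq) blast
  have [measurable]: "S \<in> borel_measurable ?M" using S by auto
  have "(\<lambda>x. S x powr (1/p)) \<in> Lp_space p \<Omega>"
    using S assms by (simp add: Lp_space_def powr_powr)
  moreover have "(\<lambda>x. norm (?D x)) \<in> Lp_space p \<Omega>" using D by (auto simp: Lp_space_def)
  ultimately have "(\<lambda>x. norm (?D x) + S x powr (1/p)) \<in> Lp_space p \<Omega>"
    using assms by (intro Lp_space_add) auto
  then show ?thesis
  proof (rule that[rotated])
    show "AE x in ?M. (\<lambda>n. \<psi> (r n) x) \<longlonglongrightarrow> u x \<and> (\<lambda>n. grad (\<psi> (r n)) x) \<longlonglongrightarrow> ?D x \<and>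
       norm (?D x) \<le> norm (?D x) + S x powr (1/p) \<and> (\<forall>n. norm (grad (\<psi> (r n)) x) \<le> norm (?D x) + S x powr (1/p))"
      using AE
    proof eventually_elim
      case (elim x)
      have "0 < p" using assms by simp
      have "(\<lambda>n. norm (\<psi> (r n) x - u x) powr p) \<longlonglongrightarrow> 0"
        by (rule tendsto_sandwich[of "\<lambda>_. 0" _ _ "\<lambda>n. F (r n) x"]) 
          (use elim in \<open>auto simp: F_def abs_minus_commute\<close>)
      from powr_LIMSEQ_0_D[OF \<open>0 < p\<close> this] have "(\<lambda>n. \<psi> (r n) x) \<longlonglongrightarrow> u x" .
      moreover
      have "(\<lambda>n. norm (grad (\<psi> (r n)) x - ?D x) powr p) \<longlonglongrightarrow> 0"
        by (rule tendsto_sandwich[of "\<lambda>_. 0" _ _ "\<lambda>n. F (r n) x"]) 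
          (use elim in \<open>auto simp: F_def norm_minus_commute\<close>)
      from powr_LIMSEQ_0_D[OF \<open>0 < p\<close> this] have "(\<lambda>n. grad (\<psi> (r n)) x) \<longlonglongrightarrow> ?D x" .
      moreover have "norm (grad (\<psi> (r n)) x) \<le> norm (?D x) + S x powr (1/p)" for n
      proof -
        have "norm (grad (\<psi> (r n)) x - ?D x) powr p \<le> F (r n) x" by (simp add: F_def norm_minus_commute)
        also have "\<dots> \<le> S x" using elim by auto
        finally have "(norm (grad (\<psi> (r n)) x - ?D x) powr p) powr (1/p) \<le> S x powr (1/p)"
          using assms by (intro powr_mono2) auto
        then have "norm (grad (\<psi> (r n)) x - ?D x) \<le> S x powr (1/p)" using assms by (simp add: powr_powr)
        then show ?thesis using norm_triangle_sub[of "grad (\<psi> (r n)) x" "?D x"] by linarith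
      qed
      ultimately show ?case by simp
    qed
  qed (use \<psi> in auto)
qed

text \<open>The common form of all passages to the limit in the weak inequality. It is stated for fields \<open>G n\<close> and \<open>G'\<close>
  rather than for gradients, as the limit field is known by a formula only.\<close>

lemma weak_inequality_limit:
  fixes A :: "'a \<Rightarrow> 'b::euclidean_space" and f h k \<phi> :: "'a \<Rightarrow> real"
  assumes ineq: "\<And>n. (LINT x|M. A x \<bullet> G n x) \<le> (LINT x|M. f x * \<psi> n x)"
    and [measurable]: "A \<in> borel_measurable M" "\<And>n. G n \<in> borel_measurable M" "G' \<in> borel_measurable M"
      "f \<in> borel_measurable M" "\<And>n. \<psi> n \<in> borel_measurable M" "\<phi> \<in> borel_measurable M"
    and G: "AE x in M. (\<lambda>n. G n x) \<longlonglongrightarrow> G' x" "\<And>n. AE x in M. norm (G n x) \<le> C * h x"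
      "integrable M (\<lambda>x. norm (A x) * h x)"
    and \<psi>: "AE x in M. (\<lambda>n. \<psi> n x) \<longlonglongrightarrow> \<phi> x" "\<And>n. AE x in M. \<bar>f x * \<psi> n x\<bar> \<le> k x" "integrable M k"
  shows "(LINT x|M. A x \<bullet> G' x) \<le> (LINT x|M. f x * \<phi> x)"
proof (rule LIMSEQ_le)
  show "(\<lambda>n. LINT x|M. A x \<bullet> G n x) \<longlonglongrightarrow> (LINT x|M. A x \<bullet> G' x)"
  proof (rule integral_dominated_convergence)
    show "integrable M (\<lambda>x. C * (norm (A x) * h x))" using G(3) by simp
    show "AE x in M. (\<lambda>n. A x \<bullet> G n x) \<longlonglongrightarrow> A x \<bullet> G' x"
      using G(1) by eventually_elim (intro tendsto_intros)
    show "AE x in M. norm (A x \<bullet> G n x) \<le> C * (norm (A x) * h x)" for n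
      using G(2)[of n]
    proof eventually_elim
      case (elim x)
      have "norm (A x \<bullet> G n x) \<le> norm (A x) * norm (G n x)" using Cauchy_Schwarz_ineq2 by simp
      also have "\<dots> \<le> norm (A x) * (C * h x)" using elim by (intro mult_left_mono) auto
      finally show ?case by (simp add: algebra_simps)
    qed
  qed measurable
  show "(\<lambda>n. LINT x|M. f x * \<psi> n x) \<longlonglongrightarrow> (LINT x|M. f x * \<phi> x)"
  proof (rule integral_dominated_convergence)
    show "AE x in M. (\<lambda>n. f x * \<psi> n x) \<longlonglongrightarrow> f x * \<phi> x"
      using \<psi>(1) by eventually_elim (intro tendsto_intros)
    show "AE x in M. norm (f x * \<psi> n x) \<le> k x" for n using \<psi>(2)[of n] by simp
    show "integrable M k" by (rule \<psi>(3))
  qed measurable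
qed (use ineq in auto)

lemma borel_measurable_lebesgue_on_AE:
  fixes f g :: "'a::euclidean_space \<Rightarrow> real"
  assumes S: "S \<in> sets lebesgue" and f: "f \<in> borel_measurable (lebesgue_on S)"
    and eq: "AE x in lebesgue_on S. f x = g x"
  shows "g \<in> borel_measurable (lebesgue_on S)"
proof -
  have "(\<lambda>x. if x \<in> S then f x else 0) \<in> borel_measurable lebesgue"
    using f S by (simp add: borel_measurable_if)
  moreover have "AE x in lebesgue. (if x \<in> S then f x else 0) = (if x \<in> S then g x else 0)"
    using eq S by (auto simp: AE_restrict_space_iff)
  ultimately have "(\<lambda>x. if x \<in> S then g x else 0) \<in> borel_measurable lebesgue"
    by (rule borel_measurable_AE)
  then show ?thesis using S by (simp add: borel_measurable_if)
qed

text \<open>Round \<open>u\<close> up to the next multiple of \<open>1/2\<^sup>n\<close>. The rounded function takes countably many values, all of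
  them positive, and continuity of \<open>g x\<close> gives the limit. The limit is only attained almost everywhere, and
  completeness of the Lebesgue measure absorbs this.\<close>

lemma caratheodory_compose_measurable:
  assumes \<Omega>: "\<Omega> \<in> sets lebesgue" and g: "caratheodory \<Omega> g"
    and u[measurable]: "u \<in> borel_measurable (lebesgue_on \<Omega>)" and pos: "AE x in lebesgue_on \<Omega>. 0 < u x"
  shows "(\<lambda>x. g x (u x)) \<in> borel_measurable (lebesgue_on \<Omega>)"
proof -
  let ?M = "lebesgue_on \<Omega>"
  define a where "a n x = nat \<lfloor>u x * 2 ^ n\<rfloor>" for n x
  define U where "U n x = (real (a n x) + 1) / 2 ^ n" for n x
  have [measurable]: "(\<lambda>x. g x (U n x)) \<in> borel_measurable ?M" for n
    unfolding U_def
  proof (rule measurable_compose_countable[where g="a n"])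
    show "a n \<in> ?M \<rightarrow>\<^sub>M count_space UNIV" unfolding a_def by measurable
    show "(\<lambda>x. g x ((real i + 1) / 2 ^ n)) \<in> borel_measurable ?M" for i
      using g by (auto simp: caratheodory_def)
  qed
  have cont: "AE x in ?M. continuous_on {0<..} (g x)" using g by (simp add: caratheodory_def)
  have conv: "AE x in ?M. (\<lambda>n. g x (U n x)) \<longlonglongrightarrow> g x (u x)"
    using pos cont
  proof eventually_elim
    case (elim x)
    have U: "u x \<le> U n x" "U n x \<le> u x + (1/2) ^ n" for n
    proof -
      have "real (a n x) \<le> u x * 2 ^ n" "u x * 2 ^ n \<le> real (a n x) + 1" 
      proof -
        have "0 \<le> u x * 2 ^ n" using elim by simp
        then have "real (a n x) = of_int \<lfloor>u x * 2 ^ n\<rfloor>" unfolding a_def by (simp add: of_nat_nat)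
        then show "real (a n x) \<le> u x * 2 ^ n" "u x * 2 ^ n \<le> real (a n x) + 1" by linarith+
      qed
      then show "u x \<le> U n x" "U n x \<le> u x + (1/2) ^ n" 
        by (auto simp: U_def field_simps power_one_over)
    qed
    have "(\<lambda>n. U n x) \<longlonglongrightarrow> u x"
    proof (rule tendsto_sandwich[of "\<lambda>_. u x" _ _ "\<lambda>n. u x + (1/2) ^ n"])
      have "(\<lambda>n. u x + (1/2) ^ n) \<longlonglongrightarrow> u x + 0" by (intro tendsto_intros LIMSEQ_realpow_zero) auto
      then show "(\<lambda>n. u x + (1/2) ^ n) \<longlonglongrightarrow> u x" by simp
    qed (use U in auto)
    moreover have "0 < U n x" for n using U(1)[of n] elim by linarith
    ultimately show ?case using elim
      by (intro continuous_on_tendsto_compose[of "{0<..}" "g x"]) auto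
  qed
  have "AE x in ?M. lim (\<lambda>n. g x (U n x)) = g x (u x)"
    using conv by eventually_elim (rule limI)
  then show ?thesis 
    by (rule borel_measurable_lebesgue_on_AE[OF \<Omega>, rotated]) measurable
qed

section \<open>The weak inequality for the Diaz-Saa test functions\<close>

lemma ds_test_measurable [measurable (raw)]:
  assumes [measurable]: "f \<in> borel_measurable M" "g \<in> borel_measurable M"
  shows "(\<lambda>x. ds_test q a b \<eta> (f x) (g x)) \<in> borel_measurable M"
    "(\<lambda>x. ds_test_dU q a b \<eta> (f x) (g x)) \<in> borel_measurable M"
    "(\<lambda>x. ds_test_dV q a b \<eta> (f x) (g x)) \<in> borel_measurable M"
  unfolding ds_test_def ds_test_dU_def ds_test_dV_def soft_pos_def soft_step_def soft_sgn_def soft_abs_def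
  by measurable

lemma cutoff_measurable [measurable (raw)]:
  assumes [measurable]: "f \<in> borel_measurable M"
  shows "(\<lambda>x. cutoff \<sigma> (f x)) \<in> borel_measurable M"
    "(\<lambda>x. cutoff_deriv \<sigma> (f x)) \<in> borel_measurable M"
    "(\<lambda>x. soft_clamp R \<eta> (f x)) \<in> borel_measurable M"
    "(\<lambda>x. soft_clamp_deriv R \<eta> (f x)) \<in> borel_measurable M"
  unfolding cutoff_def cutoff_deriv_def soft_clamp_def soft_clamp_deriv_def soft_sgn_def soft_abs_def
  by measurable

lemma tendsto_ds_test_step:
  assumes "(U \<longlongrightarrow> U0) F" "(V \<longlongrightarrow> V0) F" "0 < U0" "0 < V0" "0 < \<eta>"
  shows "((\<lambda>n. ds_test q a b \<eta> (U n) (V n)) \<longlongrightarrow> ds_test q a b \<eta> U0 V0) F"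
    "((\<lambda>n. ds_test_dU q a b \<eta> (U n) (V n)) \<longlongrightarrow> ds_test_dU q a b \<eta> U0 V0) F"
    "((\<lambda>n. ds_test_dV q a b \<eta> (U n) (V n)) \<longlongrightarrow> ds_test_dV q a b \<eta> U0 V0) F"
  unfolding ds_test_def ds_test_dU_def ds_test_dV_def using assms
  by (intro tendsto_intros tendsto_soft_pos tendsto_soft_step; simp)+

lemma tendsto_ds_test_0:
  assumes "(e \<longlongrightarrow> 0) F"
  shows "((\<lambda>n. ds_test q a b (e n) U V) \<longlongrightarrow> ds_test q a b 0 U V) F"
    "((\<lambda>n. ds_test_dU q a b (e n) U V) \<longlongrightarrow> ds_test_dU q a b 0 U V) F"
    "((\<lambda>n. ds_test_dV q a b (e n) U V) \<longlongrightarrow> ds_test_dV q a b 0 U V) F"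
  unfolding ds_test_def ds_test_dU_def ds_test_dV_def using assms
  by (intro tendsto_intros tendsto_soft_pos tendsto_soft_step_0; simp)+

text \<open>The gradient of \<open>cutoff \<sigma> r * L\<close> by the product rule, when \<open>L\<close> has the partial derivatives \<open>LU\<close>, \<open>LV\<close>
  with respect to functions with gradients \<open>X\<close>, \<open>Y\<close>.\<close>

definition cut_grad :: "real \<Rightarrow> real \<Rightarrow> 'a::real_vector \<Rightarrow> real \<Rightarrow> real \<Rightarrow> real \<Rightarrow> 'a \<Rightarrow> 'a \<Rightarrow> 'a" where
  "cut_grad \<sigma> r Dr L LU LV X Y = cutoff \<sigma> r *\<^sub>R (LU *\<^sub>R X + LV *\<^sub>R Y) + (L * cutoff_deriv \<sigma> r) *\<^sub>R Dr"

lemma norm_cut_grad_le: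
  fixes X Y Dr :: "'a::real_normed_vector"
  assumes "\<bar>LU\<bar> \<le> B" "\<bar>LV\<bar> \<le> B" "norm X \<le> h" "norm Y \<le> h" "norm Dr \<le> h" "\<bar>L * cutoff_deriv \<sigma> r\<bar> \<le> K"
  shows "norm (cut_grad \<sigma> r Dr L LU LV X Y) \<le> (2 * B + K) * h"
proof -
  have h: "0 \<le> h" using assms(3) norm_ge_zero order_trans by blast
  have B: "0 \<le> B" "0 \<le> K" using assms(1,6) by linarith+
  have "norm (LU *\<^sub>R X + LV *\<^sub>R Y) \<le> B * h + B * h"
    by (intro norm_triangle_mono) (auto intro!: mult_mono assms B)
  then have "cutoff \<sigma> r * norm (LU *\<^sub>R X + LV *\<^sub>R Y) \<le> 1 * (B * h + B * h)"
    using B h by (intro mult_mono cutoff_bounds) auto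
  then have "norm (cutoff \<sigma> r *\<^sub>R (LU *\<^sub>R X + LV *\<^sub>R Y)) \<le> B * h + B * h"
    using cutoff_bounds[of \<sigma> r] by simp
  moreover have "norm ((L * cutoff_deriv \<sigma> r) *\<^sub>R Dr) \<le> K * h"
    unfolding norm_scaleR using B by (intro mult_mono assms) auto
  ultimately have "norm (cut_grad \<sigma> r Dr L LU LV X Y) \<le> (B * h + B * h) + K * h"
    unfolding cut_grad_def by (rule norm_triangle_mono)
  then show ?thesis by (simp add: algebra_simps)
qed

lemma cut_grad_measurable [measurable (raw)]:
  fixes X Y Dr :: "'b \<Rightarrow> 'a::euclidean_space"
  assumes [measurable]: "r \<in> borel_measurable M" "Dr \<in> borel_measurable M" "L \<in> borel_measurable M" "LU \<in> borel_measurable M" 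
    "LV \<in> borel_measurable M" "X \<in> borel_measurable M" "Y \<in> borel_measurable M"
  shows "(\<lambda>x. cut_grad \<sigma> (r x) (Dr x) (L x) (LU x) (LV x) (X x) (Y x)) \<in> borel_measurable M"
  unfolding cut_grad_def by measurable

lemma tendsto_cut_grad:
  assumes "(s \<longlongrightarrow> \<sigma>) F" "(r \<longlongrightarrow> r0) F" "r0\<^sup>2 + \<sigma>\<^sup>2 \<noteq> 0" "(Dr \<longlongrightarrow> Dr0) F" "(L \<longlongrightarrow> L0) F" 
    "(LU \<longlongrightarrow> LU0) F" "(LV \<longlongrightarrow> LV0) F" "(X \<longlongrightarrow> X0) F" "(Y \<longlongrightarrow> Y0) F"
  shows "((\<lambda>n. cut_grad (s n) (r n) (Dr n) (L n) (LU n) (LV n) (X n) (Y n)) \<longlongrightarrow>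
     cut_grad \<sigma> r0 (Dr0::'a::real_normed_vector) L0 LU0 LV0 X0 Y0) F"
  unfolding cut_grad_def using assms by (intro tendsto_intros tendsto_cutoff)

text \<open>Two positive bounded functions \<open>u\<close>, \<open>v\<close> that are limits of test functions, with gradients dominated by \<open>h\<close>. All that
  the later limits take from the Sobolev spaces is pointwise convergence with such a bound; the lower
  bounds on compact sets make reaction terms integrable there.\<close>

locale approximated_pair =
  fixes \<Omega> :: "'a::euclidean_space set" and u v :: "'a \<Rightarrow> real" and Du Dv :: "'a \<Rightarrow> 'a"
    and un vn :: "nat \<Rightarrow> 'a \<Rightarrow> real" and h :: "'a \<Rightarrow> real" and R :: real
  assumes open_domain: "open \<Omega>" and R_nonneg: "0 \<le> R"
    and u_measurable [measurable]: "u \<in> borel_measurable (lebesgue_on \<Omega>)"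
    and v_measurable [measurable]: "v \<in> borel_measurable (lebesgue_on \<Omega>)"
    and Du_measurable [measurable]: "Du \<in> borel_measurable (lebesgue_on \<Omega>)"
    and Dv_measurable [measurable]: "Dv \<in> borel_measurable (lebesgue_on \<Omega>)"
    and un_test: "un n \<in> test_functions \<Omega>" and vn_test: "vn n \<in> test_functions \<Omega>"
    and value_bounds: "AE x in lebesgue_on \<Omega>. 0 < u x \<and> u x < R \<and> 0 < v x \<and> v x < R"
    and un_approx: "AE x in lebesgue_on \<Omega>. (\<lambda>n. un n x) \<longlonglongrightarrow> u x \<and> (\<lambda>n. grad (un n) x) \<longlonglongrightarrow> Du x \<and>
       norm (Du x) \<le> h x \<and> (\<forall>n. norm (grad (un n) x) \<le> h x)"
    and vn_approx: "AE x in lebesgue_on \<Omega>. (\<lambda>n. vn n x) \<longlonglongrightarrow> v x \<and> (\<lambda>n. grad (vn n) x) \<longlonglongrightarrow> Dv x \<and>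
       norm (Dv x) \<le> h x \<and> (\<forall>n. norm (grad (vn n) x) \<le> h x)"
    and locally_positive: "compact K \<Longrightarrow> K \<subseteq> \<Omega> \<Longrightarrow> \<exists>c>0. AE x in lebesgue_on \<Omega>. x \<in> K \<longrightarrow> c \<le> u x"
begin

definition regular_point :: "'a \<Rightarrow> bool" where
  "regular_point x \<longleftrightarrow> 0 < u x \<and> u x < R \<and> 0 < v x \<and> v x < R \<and>
     (\<lambda>n. un n x) \<longlonglongrightarrow> u x \<and> (\<lambda>n. vn n x) \<longlonglongrightarrow> v x \<and>
     (\<lambda>n. grad (un n) x) \<longlonglongrightarrow> Du x \<and> (\<lambda>n. grad (vn n) x) \<longlonglongrightarrow> Dv x \<and>
     norm (Du x) \<le> h x \<and> norm (Dv x) \<le> h x \<and> 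
     (\<forall>n. norm (grad (un n) x) \<le> h x) \<and> (\<forall>n. norm (grad (vn n) x) \<le> h x)"

lemma AE_regular_point: "AE x in lebesgue_on \<Omega>. regular_point x"
  using value_bounds un_approx vn_approx by eventually_elim (simp add: regular_point_def)

lemma smooth_approx: "smooth (un n)" "smooth (vn n)"
  using un_test[of n] vn_test[of n] unfolding test_functions_def by blast+

lemma approx_measurable [measurable]:
  "un n \<in> borel_measurable (lebesgue_on \<Omega>)" "vn n \<in> borel_measurable (lebesgue_on \<Omega>)"
  "grad (un n) \<in> borel_measurable (lebesgue_on \<Omega>)" "grad (vn n) \<in> borel_measurable (lebesgue_on \<Omega>)"
  using open_domain
  by (auto intro!: continuous_imp_measurable_on_sets_lebesgue
      intro: continuous_on_subset[OF smooth_imp_continuous[OF smooth_approx(1)]]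
      continuous_on_subset[OF smooth_imp_continuous[OF smooth_approx(2)]]
      continuous_on_subset[OF smooth_grad_continuous[OF smooth_approx(1)]]
      continuous_on_subset[OF smooth_grad_continuous[OF smooth_approx(2)]])

text \<open>Truncated and shifted approximations of \<open>u + \<epsilon>\<close> and \<open>v + \<epsilon>\<close>: they take values in \<open>{\<epsilon>..R + \<epsilon>}\<close> even where
  \<open>un n\<close> is negative or large, so their powers are smooth and all bounds are uniform.\<close>

definition U_approx :: "real \<Rightarrow> nat \<Rightarrow> 'a \<Rightarrow> real" where
  "U_approx \<epsilon> n x = soft_clamp R (1 / Suc n) (un n x) + \<epsilon>"
definition V_approx :: "real \<Rightarrow> nat \<Rightarrow> 'a \<Rightarrow> real" where
  "V_approx \<epsilon> n x = soft_clamp R (1 / Suc n) (vn n x) + \<epsilon>"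
definition DU_approx :: "nat \<Rightarrow> 'a \<Rightarrow> 'a" where
  "DU_approx n x = soft_clamp_deriv R (1 / Suc n) (un n x) *\<^sub>R grad (un n) x"
definition DV_approx :: "nat \<Rightarrow> 'a \<Rightarrow> 'a" where
  "DV_approx n x = soft_clamp_deriv R (1 / Suc n) (vn n x) *\<^sub>R grad (vn n) x"

text \<open>The support is compact because \<open>cutoff \<sigma>\<close> vanishes at \<open>0\<close>. The index \<open>m\<close> of the cutoff is kept apart from
  the index \<open>n\<close> of the arguments, so that the support stays in a fixed compact set as \<open>n \<rightarrow> \<infinity>\<close>.\<close>

definition approx_test :: "real \<Rightarrow> real \<Rightarrow> real \<Rightarrow> real \<Rightarrow> real \<Rightarrow> real \<Rightarrow> nat \<Rightarrow> nat \<Rightarrow> 'a \<Rightarrow> real" where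
  "approx_test q a b \<epsilon> \<eta> \<sigma> m n x = cutoff \<sigma> (un m x) * ds_test q a b \<eta> (U_approx \<epsilon> n x) (V_approx \<epsilon> n x)"

context
  fixes q a b \<epsilon> :: real
  assumes \<epsilon>: "0 < \<epsilon>"
begin

lemma U_approx_pos: "0 < U_approx \<epsilon> n x" "0 < V_approx \<epsilon> n x"
  using soft_clamp_bounds(1)[OF R_nonneg] \<epsilon> unfolding U_approx_def V_approx_def by (smt (verit))+

lemma smooth_U_approx: "smooth (U_approx \<epsilon> n)" "smooth (V_approx \<epsilon> n)"
  unfolding U_approx_def[abs_def] V_approx_def[abs_def]
  by (intro smooth_add smooth_soft_clamp smooth_const smooth_approx; simp)+

lemma GDERIV_U_approx: "GDERIV (U_approx \<epsilon> n) x :> DU_approx n x" "GDERIV (V_approx \<epsilon> n) x :> DV_approx n x"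
proof -
  have "GDERIV (\<lambda>x. soft_clamp R (1 / Suc n) (un n x) + \<epsilon>) x :> DU_approx n x + 0" 
    "GDERIV (\<lambda>x. soft_clamp R (1 / Suc n) (vn n x) + \<epsilon>) x :> DV_approx n x + 0"
    unfolding DU_approx_def DV_approx_def
    by (intro GDERIV_add GDERIV_const GDERIV_DERIV_compose GDERIV_grad DERIV_soft_clamp smooth_approx; simp)+
  then show "GDERIV (U_approx \<epsilon> n) x :> DU_approx n x" "GDERIV (V_approx \<epsilon> n) x :> DV_approx n x"
    by (simp_all add: U_approx_def[abs_def] V_approx_def[abs_def])
qed

lemma approx_test_is_test:
  assumes "0 < \<eta>" "0 < \<sigma>"
  shows "approx_test q a b \<epsilon> \<eta> \<sigma> m n \<in> test_functions \<Omega>" 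
proof -
  let ?\<phi> = "approx_test q a b \<epsilon> \<eta> \<sigma> m n"
  have K: "compact (closure {x. un m x \<noteq> 0})" "closure {x. un m x \<noteq> 0} \<subseteq> \<Omega>"
    using un_test[of m] unfolding test_functions_def by blast+
  have sub: "closure {x. ?\<phi> x \<noteq> 0} \<subseteq> closure {x. un m x \<noteq> 0}"
    by (rule closure_mono) (auto simp: approx_test_def cutoff_0)
  have "smooth ?\<phi>"
    unfolding approx_test_def[abs_def] using assms
    by (intro smooth_mult smooth_cutoff smooth_ds_test smooth_approx smooth_U_approx U_approx_pos)
  moreover have "compact (closure {x. ?\<phi> x \<noteq> 0})"
    using compact_Int_closed[OF K(1) closed_closure[of "{x. ?\<phi> x \<noteq> 0}"]] sub by (simp add: Int_absorb1)
  ultimately show ?thesis using K(2) sub unfolding test_functions_def by blast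
qed

lemma grad_approx_test:
  assumes "0 < \<eta>" "0 < \<sigma>"
  shows "grad (approx_test q a b \<epsilon> \<eta> \<sigma> m n) x = 
    cut_grad \<sigma> (un m x) (grad (un m) x) (ds_test q a b \<eta> (U_approx \<epsilon> n x) (V_approx \<epsilon> n x))
      (ds_test_dU q a b \<eta> (U_approx \<epsilon> n x) (V_approx \<epsilon> n x)) (ds_test_dV q a b \<eta> (U_approx \<epsilon> n x) (V_approx \<epsilon> n x)) (DU_approx n x) (DV_approx n x)"
  unfolding approx_test_def[abs_def]
  by (rule grad_eq, rule GDERIV_subst[OF GDERIV_mult[OF GDERIV_DERIV_compose[OF GDERIV_grad[OF smooth_approx(1)] DERIV_cutoff[OF assms(2)]]
       GDERIV_ds_test[OF GDERIV_U_approx U_approx_pos assms(1)]]]) (simp add: cut_grad_def)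

lemma U_approx_measurable [measurable]:
  "U_approx \<epsilon> n \<in> borel_measurable (lebesgue_on \<Omega>)" "V_approx \<epsilon> n \<in> borel_measurable (lebesgue_on \<Omega>)"
  "DU_approx n \<in> borel_measurable (lebesgue_on \<Omega>)" "DV_approx n \<in> borel_measurable (lebesgue_on \<Omega>)"
  unfolding U_approx_def[abs_def] V_approx_def[abs_def] DU_approx_def[abs_def] DV_approx_def[abs_def] by measurable

end

lemma U_approx_bounds:
  assumes "regular_point x" shows "\<epsilon> \<le> U_approx \<epsilon> n x" "U_approx \<epsilon> n x \<le> R + \<epsilon>" "\<epsilon> \<le> V_approx \<epsilon> n x" "V_approx \<epsilon> n x \<le> R + \<epsilon>"
    "norm (DU_approx n x) \<le> h x" "norm (DV_approx n x) \<le> h x"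
proof -
  show "\<epsilon> \<le> U_approx \<epsilon> n x" "U_approx \<epsilon> n x \<le> R + \<epsilon>" "\<epsilon> \<le> V_approx \<epsilon> n x" "V_approx \<epsilon> n x \<le> R + \<epsilon>"
    using soft_clamp_bounds[OF R_nonneg] by (auto simp: U_approx_def V_approx_def)
  have "norm (DU_approx n x) \<le> 1 * norm (grad (un n) x)" "norm (DV_approx n x) \<le> 1 * norm (grad (vn n) x)"
    unfolding DU_approx_def DV_approx_def norm_scaleR by (intro mult_right_mono abs_soft_clamp_deriv_le norm_ge_zero)+
  then show "norm (DU_approx n x) \<le> h x" "norm (DV_approx n x) \<le> h x"
    using assms unfolding regular_point_def by (metis mult_1 order_trans)+
qed

lemma U_approx_tendsto:
  assumes "regular_point x" 
  shows "(\<lambda>n. U_approx \<epsilon> n x) \<longlonglongrightarrow> u x + \<epsilon>" "(\<lambda>n. V_approx \<epsilon> n x) \<longlonglongrightarrow> v x + \<epsilon>"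
    "(\<lambda>n. DU_approx n x) \<longlonglongrightarrow> Du x" "(\<lambda>n. DV_approx n x) \<longlonglongrightarrow> Dv x"
proof -
  have t: "(\<lambda>n. 1 / real (Suc n)) \<longlonglongrightarrow> 0" using LIMSEQ_Suc[OF lim_const_over_n[of 1]] by simp
  note g = assms[unfolded regular_point_def]
  have un: "(\<lambda>n. un n x) \<longlonglongrightarrow> u x" "0 < u x" "u x < R" and vn: "(\<lambda>n. vn n x) \<longlonglongrightarrow> v x" "0 < v x" "v x < R"
    using g by blast+
  note lims = tendsto_soft_clamp[OF un(1) t un(2,3)] tendsto_soft_clamp[OF vn(1) t vn(2,3)]
  show "(\<lambda>n. U_approx \<epsilon> n x) \<longlonglongrightarrow> u x + \<epsilon>" "(\<lambda>n. V_approx \<epsilon> n x) \<longlonglongrightarrow> v x + \<epsilon>"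
    unfolding U_approx_def V_approx_def by (intro tendsto_intros lims)+
  have "(\<lambda>n. DU_approx n x) \<longlonglongrightarrow> 1 *\<^sub>R Du x" "(\<lambda>n. DV_approx n x) \<longlonglongrightarrow> 1 *\<^sub>R Dv x"
    unfolding DU_approx_def DV_approx_def by (intro tendsto_scaleR lims; use g in blast)+
  then show "(\<lambda>n. DU_approx n x) \<longlonglongrightarrow> Du x" "(\<lambda>n. DV_approx n x) \<longlonglongrightarrow> Dv x" by auto
qed

text \<open>On a compact set \<open>u\<close> is bounded below, so there integrability of \<open>f u\<close> gives that of \<open>f\<close>.\<close>

lemma integrable_on_support:
  assumes f: "integrable (lebesgue_on \<Omega>) (\<lambda>x. f x * u x)" and [measurable]: "f \<in> borel_measurable (lebesgue_on \<Omega>)"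
  shows "integrable (lebesgue_on \<Omega>) (\<lambda>x. indicator (closure {x. un m x \<noteq> 0}) x * \<bar>f x\<bar>)"
proof -
  let ?K = "closure {x. un m x \<noteq> 0}"
  have K: "compact ?K" "?K \<subseteq> \<Omega>" using un_test[of m] unfolding test_functions_def by blast+
  from locally_positive[OF K] obtain c where c: "0 < c" "AE x in lebesgue_on \<Omega>. x \<in> ?K \<longrightarrow> c \<le> u x" by blast
  have "?K \<in> sets (lebesgue_on \<Omega>)"
    using K open_domain by (auto simp: sets_restrict_space_iff)
  note [measurable] = this
  show ?thesis
  proof (rule Bochner_Integration.integrable_bound[OF integrable_mult_right[OF f, of "1 / c"]])
    show "AE x in lebesgue_on \<Omega>. norm (indicator ?K x * \<bar>f x\<bar>) \<le> norm (1 / c * (f x * u x))"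
      using c(2) AE_regular_point
    proof eventually_elim
      case (elim x)
      show ?case
      proof (cases "x \<in> ?K")
        case True
        then have "\<bar>f x\<bar> * c \<le> \<bar>f x\<bar> * u x" using elim by (intro mult_left_mono) auto
        then show ?thesis using True c elim by (simp add: abs_mult regular_point_def field_simps)
      qed simp
    qed
  qed measurable
qed

text \<open>The partial derivatives are bounded on the square \<open>{\<epsilon>..R + \<epsilon>}\<close>, so the field is bounded by a multiple
  of \<open>h\<close>.\<close>

lemma integrable_inner_ds_test_grad:
  assumes \<epsilon>: "0 < \<epsilon>" and A [measurable]: "A \<in> borel_measurable (lebesgue_on \<Omega>)" 
    and Ah: "integrable (lebesgue_on \<Omega>) (\<lambda>x. norm (A x) * h x)"
  shows "integrable (lebesgue_on \<Omega>) (\<lambda>x. A x \<bullet> (ds_test_dU q a b 0 (u x + \<epsilon>) (v x + \<epsilon>) *\<^sub>R Du x +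
      ds_test_dV q a b 0 (u x + \<epsilon>) (v x + \<epsilon>) *\<^sub>R Dv x))"
proof -
  from ds_test_box_bound[OF \<epsilon>, of "R + \<epsilon>" q a b] obtain B where B0: "0 \<le> B" and
    box: "\<And>\<eta> U V. \<lbrakk>0 \<le> \<eta>; \<eta> \<le> 1; \<epsilon> \<le> U; U \<le> R + \<epsilon>; \<epsilon> \<le> V; V \<le> R + \<epsilon>\<rbrakk> \<Longrightarrow>
       \<bar>ds_test q a b \<eta> U V\<bar> \<le> B \<and> \<bar>ds_test_dU q a b \<eta> U V\<bar> \<le> B \<and> \<bar>ds_test_dV q a b \<eta> U V\<bar> \<le> B" by blast
  show ?thesis
  proof (rule Bochner_Integration.integrable_bound[OF integrable_mult_right[OF Ah, of "2 * B"]])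
    show "AE x in lebesgue_on \<Omega>. norm (A x \<bullet> (ds_test_dU q a b 0 (u x + \<epsilon>) (v x + \<epsilon>) *\<^sub>R Du x +
      ds_test_dV q a b 0 (u x + \<epsilon>) (v x + \<epsilon>) *\<^sub>R Dv x)) \<le> norm (2 * B * (norm (A x) * h x))"
      using AE_regular_point
    proof eventually_elim
      case (elim x)
      define G where "G = ds_test_dU q a b 0 (u x + \<epsilon>) (v x + \<epsilon>) *\<^sub>R Du x + ds_test_dV q a b 0 (u x + \<epsilon>) (v x + \<epsilon>) *\<^sub>R Dv x"
      have b: "\<bar>ds_test_dU q a b 0 (u x + \<epsilon>) (v x + \<epsilon>)\<bar> \<le> B" "\<bar>ds_test_dV q a b 0 (u x + \<epsilon>) (v x + \<epsilon>)\<bar> \<le> B"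
        using box[of 0 "u x + \<epsilon>" "v x + \<epsilon>"] elim by (auto simp: regular_point_def)
      have "norm G \<le> B * h x + B * h x"
        unfolding G_def
      proof (rule norm_triangle_mono)
        have D: "norm (Du x) \<le> h x" "norm (Dv x) \<le> h x" using elim unfolding regular_point_def by blast+
        show "norm (ds_test_dU q a b 0 (u x + \<epsilon>) (v x + \<epsilon>) *\<^sub>R Du x) \<le> B * h x"
          "norm (ds_test_dV q a b 0 (u x + \<epsilon>) (v x + \<epsilon>) *\<^sub>R Dv x) \<le> B * h x"
          unfolding norm_scaleR by (intro mult_mono b D B0 norm_ge_zero)+
      qed
      then have "norm (A x) * norm G \<le> norm (A x) * (B * h x + B * h x)" by (rule mult_left_mono) simp
      also have "\<dots> = 2 * B * (norm (A x) * h x)" by (simp add: algebra_simps)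
      also have "\<dots> \<le> \<bar>2 * B * (norm (A x) * h x)\<bar>" by (rule abs_ge_self)
      finally show ?case
        using Cauchy_Schwarz_ineq2[of "A x" G] unfolding G_def real_norm_def by (rule order_trans[rotated])
    qed
  qed measurable
qed

text \<open>The weak inequality extends to the locally Lipschitz test function \<open>ds_test\<close> at \<open>\<eta> = 0\<close>, which is
  not compactly supported. The order of the limits matters: while the support is fixed, \<open>f\<close> itself is
  integrable on it and crude bounds suffice; once \<open>\<eta> = 0\<close>, the test function is at most \<open>C u\<close>, which
  replaces the compact support when \<open>m \<rightarrow> \<infinity>\<close> and compensates the derivative of the cutoff when \<open>\<sigma> \<rightarrow> 0\<close>.\<close>

lemma weak_inequality_ds_test:
  assumes q: "1 < q" and \<epsilon>: "0 < \<epsilon>"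
    and A [measurable]: "A \<in> borel_measurable (lebesgue_on \<Omega>)" and Ah: "integrable (lebesgue_on \<Omega>) (\<lambda>x. norm (A x) * h x)"
    and f [measurable]: "f \<in> borel_measurable (lebesgue_on \<Omega>)" and fu: "integrable (lebesgue_on \<Omega>) (\<lambda>x. f x * u x)"
    and weak: "\<And>\<phi>. \<phi> \<in> test_functions \<Omega> \<Longrightarrow> (\<And>x. 0 \<le> \<phi> x) \<Longrightarrow>
      (LINT x|lebesgue_on \<Omega>. A x \<bullet> grad \<phi> x) \<le> (LINT x|lebesgue_on \<Omega>. f x * \<phi> x)"
  shows "(LINT x|lebesgue_on \<Omega>. A x \<bullet> (ds_test_dU q a b 0 (u x + \<epsilon>) (v x + \<epsilon>) *\<^sub>R Du x +
      ds_test_dV q a b 0 (u x + \<epsilon>) (v x + \<epsilon>) *\<^sub>R Dv x))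
    \<le> (LINT x|lebesgue_on \<Omega>. f x * ds_test q a b 0 (u x + \<epsilon>) (v x + \<epsilon>))"
proof -
  let ?M = "lebesgue_on \<Omega>"
  let ?K = "\<lambda>m. closure {x. un m x \<noteq> 0}"
  define L where "L \<eta> x = ds_test q a b \<eta> (u x + \<epsilon>) (v x + \<epsilon>)" for \<eta> x
  define LU where "LU \<eta> x = ds_test_dU q a b \<eta> (u x + \<epsilon>) (v x + \<epsilon>)" for \<eta> x
  define LV where "LV \<eta> x = ds_test_dV q a b \<eta> (u x + \<epsilon>) (v x + \<epsilon>)" for \<eta> x
  have LM [measurable]: "L \<eta> \<in> borel_measurable ?M" "LU \<eta> \<in> borel_measurable ?M" "LV \<eta> \<in> borel_measurable ?M" for \<eta>
    unfolding L_def[abs_def] LU_def[abs_def] LV_def[abs_def] by measurable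
  have t: "(\<lambda>n. 1 / real (Suc n)) \<longlonglongrightarrow> 0" using LIMSEQ_Suc[OF lim_const_over_n[of 1]] by simp
  from ds_test_box_bound[OF \<epsilon>, of "R + \<epsilon>" q a b] obtain B where B0: "0 \<le> B" and
    box: "\<And>\<eta> U V. \<lbrakk>0 \<le> \<eta>; \<eta> \<le> 1; \<epsilon> \<le> U; U \<le> R + \<epsilon>; \<epsilon> \<le> V; V \<le> R + \<epsilon>\<rbrakk> \<Longrightarrow>
       \<bar>ds_test q a b \<eta> U V\<bar> \<le> B \<and> \<bar>ds_test_dU q a b \<eta> U V\<bar> \<le> B \<and> \<bar>ds_test_dV q a b \<eta> U V\<bar> \<le> B" by blast
  have bounds: "\<bar>L \<eta> x\<bar> \<le> B" "\<bar>LU \<eta> x\<bar> \<le> B" "\<bar>LV \<eta> x\<bar> \<le> B" if "regular_point x" "0 \<le> \<eta>" "\<eta> \<le> 1" for \<eta> x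
    using box[of \<eta> "u x + \<epsilon>" "v x + \<epsilon>"] that by (auto simp: L_def LU_def LV_def regular_point_def)
  define Q where "Q k = \<epsilon> powr k + (R + \<epsilon>) powr k" for k
  define C where "C = Q a * Q b * (q * Q (q - 1))"
  have Q0: "0 \<le> Q k" for k by (simp add: Q_def)
  then have C0: "0 \<le> C" using q by (simp add: C_def)
  have C: "\<bar>L 0 x\<bar> \<le> C * u x" if "regular_point x" for x
  proof -
    have UV: "0 < u x + \<epsilon>" "0 < v x + \<epsilon>" and Q: "(u x + \<epsilon>) powr k \<le> Q k" "(v x + \<epsilon>) powr k \<le> Q k" for k
      unfolding Q_def using that \<epsilon> by (auto simp: regular_point_def intro!: powr_le_sum_endpoints)
    have "\<bar>L 0 x\<bar> \<le> (u x + \<epsilon>) powr a * (v x + \<epsilon>) powr b * (q * (u x + \<epsilon>) powr (q - 1)) * max (u x - v x) 0"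
      using ds_test_le_diff[OF q UV, of a b] by (simp add: L_def ds_test_nonneg)
    also have "\<dots> \<le> C * u x"
      unfolding C_def using q that
      by (intro mult_mono mult_nonneg_nonneg Q Q0 order_refl powr_ge_zero) (auto simp: regular_point_def)
    finally show ?thesis .
  qed
  have cutoff_le: "\<bar>cutoff \<sigma> (un m x)\<bar> \<le> indicator (?K m) x" for \<sigma> m x
  proof (cases "un m x = 0")
    case False
    then have "x \<in> ?K m" using closure_subset[of "{x. un m x \<noteq> 0}"] by blast
    then show ?thesis using cutoff_bounds[of \<sigma> "un m x"] by simp
  qed (simp add: cutoff_0)
  \<comment> \<open>The limit \<open>n \<rightarrow> \<infinity>\<close>, with \<open>un n\<close>, \<open>vn n\<close> and the truncation parameter \<open>1 / Suc n\<close> moving together.\<close>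
  have tested_smooth: "(LINT x|?M. A x \<bullet> cut_grad \<sigma> (un m x) (grad (un m) x) (L \<eta> x) (LU \<eta> x) (LV \<eta> x) (Du x) (Dv x))
     \<le> (LINT x|?M. f x * (cutoff \<sigma> (un m x) * L \<eta> x))" if \<eta>: "0 < \<eta>" "\<eta> \<le> 1" and \<sigma>: "0 < \<sigma>" for \<eta> \<sigma> m
  proof (rule weak_inequality_limit[where h=h and C="2 * B + B * (1 / \<sigma>)" and k="\<lambda>x. B * (indicator (?K m) x * \<bar>f x\<bar>)"])
    show "(LINT x|?M. A x \<bullet> grad (approx_test q a b \<epsilon> \<eta> \<sigma> m n) x) \<le> (LINT x|?M. f x * approx_test q a b \<epsilon> \<eta> \<sigma> m n x)" for n
      using \<eta> \<sigma> cutoff_bounds(1)[of \<sigma>] ds_test_nonneg 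
      by (intro weak approx_test_is_test[OF \<epsilon>]) (auto simp: approx_test_def)
    note [measurable] = U_approx_measurable[OF \<epsilon>]
    show "grad (approx_test q a b \<epsilon> \<eta> \<sigma> m n) \<in> borel_measurable ?M" for n
      by (subst measurable_cong[OF grad_approx_test[OF \<epsilon> \<eta>(1) \<sigma>]]) measurable
    show "approx_test q a b \<epsilon> \<eta> \<sigma> m n \<in> borel_measurable ?M" for n
      unfolding approx_test_def[abs_def] by measurable
    show "AE x in ?M. (\<lambda>n. grad (approx_test q a b \<epsilon> \<eta> \<sigma> m n) x) \<longlonglongrightarrow>
       cut_grad \<sigma> (un m x) (grad (un m) x) (L \<eta> x) (LU \<eta> x) (LV \<eta> x) (Du x) (Dv x)"
      using AE_regular_point unfolding grad_approx_test[OF \<epsilon> \<eta>(1) \<sigma>] L_def LU_def LV_def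
    proof eventually_elim
      case (elim x)
      then show ?case using \<eta> \<sigma> \<epsilon>
        by (intro tendsto_cut_grad tendsto_ds_test_step U_approx_tendsto tendsto_const) (auto simp: regular_point_def add_nonneg_pos)
    qed
    show "AE x in ?M. norm (grad (approx_test q a b \<epsilon> \<eta> \<sigma> m n) x) \<le> (2 * B + B * (1 / \<sigma>)) * h x" for n
      using AE_regular_point unfolding grad_approx_test[OF \<epsilon> \<eta>(1) \<sigma>]
    proof eventually_elim
      case (elim x)
      note b = box[OF less_imp_le[OF \<eta>(1)] \<eta>(2) U_approx_bounds(1-4)[OF elim, of \<epsilon> n]]
      show ?case
      proof (rule norm_cut_grad_le)
        show "\<bar>ds_test q a b \<eta> (U_approx \<epsilon> n x) (V_approx \<epsilon> n x) * cutoff_deriv \<sigma> (un m x)\<bar> \<le> B * (1 / \<sigma>)"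
          unfolding abs_mult using b B0 by (intro mult_mono abs_cutoff_deriv_le \<sigma>) auto
        show "norm (grad (un m) x) \<le> h x" using elim by (simp add: regular_point_def)
      qed (use b U_approx_bounds[OF elim] in auto)
    qed
    show "AE x in ?M. (\<lambda>n. approx_test q a b \<epsilon> \<eta> \<sigma> m n x) \<longlonglongrightarrow> cutoff \<sigma> (un m x) * L \<eta> x"
      using AE_regular_point unfolding approx_test_def L_def
    proof eventually_elim
      case (elim x)
      then show ?case using \<eta> \<epsilon>
        by (intro tendsto_mult tendsto_ds_test_step U_approx_tendsto tendsto_const) (auto simp: regular_point_def add_nonneg_pos)
    qed
    show "AE x in ?M. \<bar>f x * approx_test q a b \<epsilon> \<eta> \<sigma> m n x\<bar> \<le> B * (indicator (?K m) x * \<bar>f x\<bar>)" for n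
      using AE_regular_point
    proof eventually_elim
      case (elim x)
      note b = box[OF less_imp_le[OF \<eta>(1)] \<eta>(2) U_approx_bounds(1-4)[OF elim, of \<epsilon> n]]
      have "\<bar>f x\<bar> * (\<bar>cutoff \<sigma> (un m x)\<bar> * \<bar>ds_test q a b \<eta> (U_approx \<epsilon> n x) (V_approx \<epsilon> n x)\<bar>) \<le> \<bar>f x\<bar> * (indicator (?K m) x * B)"
        using b B0 by (intro mult_left_mono mult_mono cutoff_le) auto
      then show ?case by (simp add: approx_test_def abs_mult algebra_simps)
    qed
    show "integrable ?M (\<lambda>x. B * (indicator (?K m) x * \<bar>f x\<bar>))"
      using integrable_on_support[OF fu f] by simp
  qed (intro Ah A f cut_grad_measurable borel_measurable_times cutoff_measurable(1) approx_measurable LM u_measurable Du_measurable Dv_measurable)+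
  \<comment> \<open>The limit \<open>\<eta> \<rightarrow> 0\<close>, still on the support of \<open>un m\<close>.\<close>
  have tested_pos: "(LINT x|?M. A x \<bullet> cut_grad \<sigma> (un m x) (grad (un m) x) (L 0 x) (LU 0 x) (LV 0 x) (Du x) (Dv x))
     \<le> (LINT x|?M. f x * (cutoff \<sigma> (un m x) * L 0 x))" if \<sigma>: "0 < \<sigma>" for \<sigma> m
  proof (rule weak_inequality_limit[where h=h and C="2 * B + B * (1 / \<sigma>)" and k="\<lambda>x. B * (indicator (?K m) x * \<bar>f x\<bar>)"])
    let ?e = "\<lambda>n. 1 / real (Suc n)"
    have e: "0 < ?e n" "?e n \<le> 1" "0 \<le> ?e n" for n by auto
    show "(LINT x|?M. A x \<bullet> cut_grad \<sigma> (un m x) (grad (un m) x) (L (?e n) x) (LU (?e n) x) (LV (?e n) x) (Du x) (Dv x))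
     \<le> (LINT x|?M. f x * (cutoff \<sigma> (un m x) * L (?e n) x))" for n by (rule tested_smooth[OF e(1,2) \<sigma>])
    show "AE x in ?M. (\<lambda>n. cut_grad \<sigma> (un m x) (grad (un m) x) (L (?e n) x) (LU (?e n) x) (LV (?e n) x) (Du x) (Dv x)) \<longlonglongrightarrow>
       cut_grad \<sigma> (un m x) (grad (un m) x) (L 0 x) (LU 0 x) (LV 0 x) (Du x) (Dv x)"
      unfolding L_def LU_def LV_def
      using \<sigma> by (intro AE_I2 tendsto_cut_grad tendsto_ds_test_0 t tendsto_const) (auto simp: add_nonneg_pos)
    show "AE x in ?M. norm (cut_grad \<sigma> (un m x) (grad (un m) x) (L (?e n) x) (LU (?e n) x) (LV (?e n) x) (Du x) (Dv x)) \<le> (2 * B + B * (1 / \<sigma>)) * h x" for n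
      using AE_regular_point
    proof eventually_elim
      case (elim x)
      note b = bounds[OF elim e(3,2)[of n]]
      show ?case
      proof (rule norm_cut_grad_le)
        show "\<bar>L (?e n) x * cutoff_deriv \<sigma> (un m x)\<bar> \<le> B * (1 / \<sigma>)"
          unfolding abs_mult using b B0 by (intro mult_mono abs_cutoff_deriv_le \<sigma>) auto
      qed (use b elim in \<open>auto simp: regular_point_def\<close>)
    qed
    show "AE x in ?M. (\<lambda>n. cutoff \<sigma> (un m x) * L (?e n) x) \<longlonglongrightarrow> cutoff \<sigma> (un m x) * L 0 x"
      unfolding L_def by (intro AE_I2 tendsto_intros tendsto_ds_test_0 t)
    show "AE x in ?M. \<bar>f x * (cutoff \<sigma> (un m x) * L (?e n) x)\<bar> \<le> B * (indicator (?K m) x * \<bar>f x\<bar>)" for n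
      using AE_regular_point
    proof eventually_elim
      case (elim x)
      note b = bounds[OF elim e(3,2)[of n]]
      have "\<bar>f x\<bar> * (\<bar>cutoff \<sigma> (un m x)\<bar> * \<bar>L (?e n) x\<bar>) \<le> \<bar>f x\<bar> * (indicator (?K m) x * B)"
        using b B0 by (intro mult_left_mono mult_mono cutoff_le) auto
      then show ?case by (simp add: abs_mult algebra_simps)
    qed
    show "integrable ?M (\<lambda>x. B * (indicator (?K m) x * \<bar>f x\<bar>))"
      using integrable_on_support[OF fu f] by simp
  qed (intro Ah A f cut_grad_measurable borel_measurable_times cutoff_measurable(1) approx_measurable LM u_measurable Du_measurable Dv_measurable)+
  have fu': "integrable ?M (\<lambda>x. C * \<bar>f x * u x\<bar>)" using fu by simp
  have fC: "\<bar>f x * (cutoff \<sigma> r * L 0 x)\<bar> \<le> C * \<bar>f x * u x\<bar>" if "regular_point x" for x \<sigma> r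
  proof -
    have "\<bar>f x\<bar> * (\<bar>cutoff \<sigma> r\<bar> * \<bar>L 0 x\<bar>) \<le> \<bar>f x\<bar> * (1 * (C * u x))"
      using C[OF that] cutoff_bounds[of \<sigma> r] by (intro mult_left_mono mult_mono) auto
    then show ?thesis using that by (simp add: abs_mult regular_point_def algebra_simps)
  qed
  \<comment> \<open>The limit \<open>m \<rightarrow> \<infinity>\<close>: the reaction term is now dominated through \<open>L 0 \<le> C u\<close>.\<close>
  have tested_cutoff: "(LINT x|?M. A x \<bullet> cut_grad \<sigma> (u x) (Du x) (L 0 x) (LU 0 x) (LV 0 x) (Du x) (Dv x))
     \<le> (LINT x|?M. f x * (cutoff \<sigma> (u x) * L 0 x))" if \<sigma>: "0 < \<sigma>" for \<sigma>
  proof (rule weak_inequality_limit[where h=h and C="2 * B + B * (1 / \<sigma>)" and k="\<lambda>x. C * \<bar>f x * u x\<bar>"])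
    show "(LINT x|?M. A x \<bullet> cut_grad \<sigma> (un m x) (grad (un m) x) (L 0 x) (LU 0 x) (LV 0 x) (Du x) (Dv x))
     \<le> (LINT x|?M. f x * (cutoff \<sigma> (un m x) * L 0 x))" for m by (rule tested_pos[OF \<sigma>])
    show "AE x in ?M. (\<lambda>m. cut_grad \<sigma> (un m x) (grad (un m) x) (L 0 x) (LU 0 x) (LV 0 x) (Du x) (Dv x)) \<longlonglongrightarrow>
       cut_grad \<sigma> (u x) (Du x) (L 0 x) (LU 0 x) (LV 0 x) (Du x) (Dv x)"
      using AE_regular_point
    proof eventually_elim
      case (elim x)
      then show ?case using \<sigma> by (intro tendsto_cut_grad tendsto_const) (auto simp: regular_point_def add_nonneg_pos)
    qed
    show "AE x in ?M. norm (cut_grad \<sigma> (un m x) (grad (un m) x) (L 0 x) (LU 0 x) (LV 0 x) (Du x) (Dv x)) \<le> (2 * B + B * (1 / \<sigma>)) * h x" for m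
      using AE_regular_point
    proof eventually_elim
      case (elim x)
      note b = bounds[OF elim, of 0, simplified]
      show ?case
      proof (rule norm_cut_grad_le)
        show "\<bar>L 0 x * cutoff_deriv \<sigma> (un m x)\<bar> \<le> B * (1 / \<sigma>)"
          unfolding abs_mult using b B0 by (intro mult_mono abs_cutoff_deriv_le \<sigma>) auto
      qed (use b elim in \<open>auto simp: regular_point_def\<close>)
    qed
    show "AE x in ?M. (\<lambda>m. cutoff \<sigma> (un m x) * L 0 x) \<longlonglongrightarrow> cutoff \<sigma> (u x) * L 0 x"
      using AE_regular_point
    proof eventually_elim
      case (elim x)
      then show ?case using \<sigma> by (intro tendsto_intros tendsto_cutoff) (auto simp: regular_point_def add_nonneg_pos)
    qed
    show "AE x in ?M. \<bar>f x * (cutoff \<sigma> (un m x) * L 0 x)\<bar> \<le> C * \<bar>f x * u x\<bar>" for m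
      using AE_regular_point by eventually_elim (rule fC)
  qed (intro Ah fu' A f cut_grad_measurable borel_measurable_times cutoff_measurable(1) approx_measurable LM u_measurable Du_measurable Dv_measurable)+
  \<comment> \<open>The limit \<open>\<sigma> \<rightarrow> 0\<close>: \<open>cutoff 0\<close> is \<open>1\<close> at positive arguments and its formal derivative is \<open>0\<close>.\<close>
  have "(LINT x|?M. A x \<bullet> cut_grad 0 (u x) (Du x) (L 0 x) (LU 0 x) (LV 0 x) (Du x) (Dv x))
     \<le> (LINT x|?M. f x * (cutoff 0 (u x) * L 0 x))"
  proof (rule weak_inequality_limit[where h=h and C="2 * B + C" and k="\<lambda>x. C * \<bar>f x * u x\<bar>"])
    let ?e = "\<lambda>n. 1 / real (Suc n)"
    show "(LINT x|?M. A x \<bullet> cut_grad (?e n) (u x) (Du x) (L 0 x) (LU 0 x) (LV 0 x) (Du x) (Dv x))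
     \<le> (LINT x|?M. f x * (cutoff (?e n) (u x) * L 0 x))" for n by (rule tested_cutoff) simp
    show "AE x in ?M. (\<lambda>n. cut_grad (?e n) (u x) (Du x) (L 0 x) (LU 0 x) (LV 0 x) (Du x) (Dv x)) \<longlonglongrightarrow>
       cut_grad 0 (u x) (Du x) (L 0 x) (LU 0 x) (LV 0 x) (Du x) (Dv x)"
      using AE_regular_point
    proof eventually_elim
      case (elim x)
      then show ?case by (intro tendsto_cut_grad tendsto_const t) (auto simp: regular_point_def)
    qed
    show "AE x in ?M. norm (cut_grad (?e n) (u x) (Du x) (L 0 x) (LU 0 x) (LV 0 x) (Du x) (Dv x)) \<le> (2 * B + C) * h x" for n
      using AE_regular_point
    proof eventually_elim
      case (elim x)
      note b = bounds[OF elim, of 0, simplified]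
      show ?case
      proof (rule norm_cut_grad_le)
        have "\<bar>L 0 x\<bar> * \<bar>cutoff_deriv (?e n) (u x)\<bar> \<le> C * u x * \<bar>cutoff_deriv (?e n) (u x)\<bar>"
          by (intro mult_right_mono C elim) auto
        also have "\<dots> = C * \<bar>u x * cutoff_deriv (?e n) (u x)\<bar>" using elim by (simp add: abs_mult regular_point_def)
        also have "\<dots> \<le> C * 1" by (intro mult_left_mono cutoff_deriv_mult_le C0)
        finally show "\<bar>L 0 x * cutoff_deriv (?e n) (u x)\<bar> \<le> C" by (simp add: abs_mult)
      qed (use b elim in \<open>auto simp: regular_point_def\<close>)
    qed
    show "AE x in ?M. (\<lambda>n. cutoff (?e n) (u x) * L 0 x) \<longlonglongrightarrow> cutoff 0 (u x) * L 0 x"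
      using AE_regular_point
    proof eventually_elim
      case (elim x)
      then show ?case by (intro tendsto_intros tendsto_cutoff t) (auto simp: regular_point_def)
    qed
    show "AE x in ?M. \<bar>f x * (cutoff (?e n) (u x) * L 0 x)\<bar> \<le> C * \<bar>f x * u x\<bar>" for n
      using AE_regular_point by eventually_elim (rule fC)
  qed (intro Ah fu' A f cut_grad_measurable borel_measurable_times cutoff_measurable(1) approx_measurable LM u_measurable Du_measurable Dv_measurable)+
  also have "(LINT x|?M. f x * (cutoff 0 (u x) * L 0 x)) = (LINT x|?M. f x * L 0 x)"
    using AE_regular_point by (intro integral_cong_AE) (auto elim!: eventually_mono simp: regular_point_def cutoff_def)
  also have "(LINT x|?M. A x \<bullet> cut_grad 0 (u x) (Du x) (L 0 x) (LU 0 x) (LV 0 x) (Du x) (Dv x)) =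
    (LINT x|?M. A x \<bullet> (LU 0 x *\<^sub>R Du x + LV 0 x *\<^sub>R Dv x))"
    using AE_regular_point by (intro integral_cong_AE) (auto elim!: eventually_mono simp: regular_point_def cutoff_def cutoff_deriv_def cut_grad_def)
  finally show ?thesis by (simp add: L_def LU_def LV_def)
qed

end

section \<open>The flux and the reaction term\<close>

lemma Linf_space_AE_bound:
  assumes "u \<in> Linf_space \<Omega>"
  obtains R where "AE x in lebesgue_on \<Omega>. \<bar>u x\<bar> < R"
proof -
  have "esssup (lebesgue_on \<Omega>) (\<lambda>x. ereal \<bar>u x\<bar>) < \<infinity>" using assms by (simp add: Linf_space_def)
  then obtain R where R: "esssup (lebesgue_on \<Omega>) (\<lambda>x. ereal \<bar>u x\<bar>) < ereal R" using ereal_dense2 by blast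
  have "AE x in lebesgue_on \<Omega>. \<bar>u x\<bar> < R"
    using esssup_AE[of "\<lambda>x. ereal \<bar>u x\<bar>" "lebesgue_on \<Omega>"]
  proof eventually_elim
    case (elim x)
    then have "ereal \<bar>u x\<bar> < ereal R" using R by (rule order.strict_trans1)
    then show ?case by simp
  qed
  then show ?thesis by (rule that)
qed

lemma positive_in_compact_lower_bound:
  assumes "positive_in \<Omega> u" "compact K" "K \<subseteq> \<Omega>" "open \<Omega>"
  shows "\<exists>c>0. AE x in lebesgue_on \<Omega>. x \<in> K \<longrightarrow> c \<le> u x"
proof -
  let ?e = "esssup (lebesgue_on K) (\<lambda>x. ereal (- u x))"
  have "0 < - ?e" using assms unfolding positive_in_def essinf_def by blast
  then have "?e < 0" by (simp add: ereal_less_uminus_reorder)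
  then obtain z where z: "?e < ereal z" "ereal z < 0" using ereal_dense2 by blast
  have "AE x in lebesgue_on K. - z \<le> u x"
    using esssup_AE[of "\<lambda>x. ereal (- u x)" "lebesgue_on K"]
  proof eventually_elim
    case (elim x)
    then have "ereal (- u x) < ereal z" using z(1) by (rule order.strict_trans1)
    then show ?case by simp
  qed
  then have "AE x in lebesgue. x \<in> K \<longrightarrow> - z \<le> u x"
    using assms by (subst (asm) AE_restrict_space_iff) (auto simp: compact_imp_closed)
  then have "AE x in lebesgue. x \<in> \<Omega> \<longrightarrow> (x \<in> K \<longrightarrow> - z \<le> u x)"
    by eventually_elim auto
  then have "AE x in lebesgue_on \<Omega>. x \<in> K \<longrightarrow> - z \<le> u x"
    using assms by (subst AE_restrict_space_iff) auto
  then show ?thesis using z(2) by (intro exI[of _ "- z"]) auto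
qed

text \<open>The quotient at \<open>t\<close> lies between those at \<open>s\<close> and \<open>r\<close>; multiplying back by \<open>t powr k\<close> costs at most the factor
  \<open>(r / s) powr k\<close>.\<close>

lemma quotient_antimono_abs_le:
  fixes g :: "real \<Rightarrow> real"
  assumes anti: "antimono_on {0<..} (\<lambda>s. g s / s powr k)" and "0 \<le> k" "0 < s" "s \<le> t" "t \<le> r"
  shows "\<bar>g t\<bar> \<le> (r / s) powr k * \<bar>g s\<bar> + \<bar>g r\<bar>"
proof -
  have pos: "0 < t" "0 < r" using assms by auto
  have ratio: "0 \<le> (t / a) powr k" for a by simp
  have "g t / t powr k \<le> g s / s powr k" "g r / r powr k \<le> g t / t powr k"
    using anti assms pos by (auto simp: monotone_on_def)
  then have 1: "g t \<le> (t / s) powr k * g s" "(t / r) powr k * g r \<le> g t"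
    using assms pos by (auto simp: powr_divide field_simps)
  have "(t / s) powr k * g s \<le> (t / s) powr k * \<bar>g s\<bar>" by (intro mult_left_mono) auto
  also have "\<dots> \<le> (r / s) powr k * \<bar>g s\<bar>"
    using assms by (intro mult_right_mono powr_mono2 divide_right_mono) auto
  finally have 2: "(t / s) powr k * g s \<le> (r / s) powr k * \<bar>g s\<bar>" .
  have "(t / r) powr k \<le> 1 powr k" using assms pos by (intro powr_mono2) auto
  then have "(t / r) powr k * \<bar>g r\<bar> \<le> 1 * \<bar>g r\<bar>" by (intro mult_right_mono) auto
  moreover have "- ((t / r) powr k * g r) \<le> (t / r) powr k * \<bar>g r\<bar>"
    unfolding mult_minus_right[symmetric] by (intro mult_left_mono) auto
  moreover have "0 \<le> (r / s) powr k * \<bar>g s\<bar>" by simp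
  ultimately show ?thesis using 1 2 by linarith
qed

lemma singular_reaction_quotient_less:
  fixes g :: "real \<Rightarrow> real"
  assumes anti: "antimono_on {0<..} (\<lambda>s. g s / s powr (q - 1))" and "1 < q" "0 < \<delta>" "0 < t" "t < s"
  shows "(s powr (- \<delta>) + g s) * s powr (1 - q) < (t powr (- \<delta>) + g t) * t powr (1 - q)"
proof -
  have s: "0 < s" using assms by simp
  have "g s / s powr (q - 1) \<le> g t / t powr (q - 1)"
    using anti assms s by (auto simp: monotone_on_def)
  then have "g s * s powr (1 - q) \<le> g t * t powr (1 - q)"
    using powr_minus_divide[of s "q - 1"] powr_minus_divide[of t "q - 1"] by simp
  moreover have "s powr (- \<delta> + (1 - q)) < t powr (- \<delta> + (1 - q))"
    using assms by (intro powr_less_mono2_neg) auto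
  ultimately show ?thesis unfolding powr_add distrib_right by linarith
qed

definition pq_flux :: "real \<Rightarrow> real \<Rightarrow> 'a::euclidean_space \<Rightarrow> 'a" where
  "pq_flux p q X = (norm X powr (p - 2) + norm X powr (q - 2)) *\<^sub>R X"

lemma pq_laplace_form_flux:
  "pq_laplace_form p q \<Omega> u \<phi> = (LINT x|lebesgue_on \<Omega>. pq_flux p q (weak_grad \<Omega> u x) \<bullet> grad \<phi> x)"
  by (simp add: pq_laplace_form_def pq_flux_def)

lemma norm_pq_flux: "norm (pq_flux p q X) = norm X powr (p - 1) + norm X powr (q - 1)"
proof (cases "X = 0")
  case False
  then have r: "norm X powr (r - 1) = norm X powr (r - 2) * norm X" for r
    using powr_add[of "norm X" "r - 2" 1] by simp
  show ?thesis by (simp add: pq_flux_def r distrib_right)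
qed (simp add: pq_flux_def)

lemma pq_flux_mult_le:
  assumes "1 < q" "q < p" "norm X \<le> h"
  shows "norm (pq_flux p q X) * h \<le> 2 * h powr p + 1"
proof -
  have h: "0 \<le> h" using assms(3) norm_ge_zero order_trans by blast
  have hr: "h powr (r - 1) * h = h powr r" for r 
    using powr_add[of h "r - 1" 1] h by (cases "h = 0") auto
  have "norm (pq_flux p q X) * h \<le> (h powr (p - 1) + h powr (q - 1)) * h"
    unfolding norm_pq_flux using assms h by (intro mult_right_mono add_mono powr_mono2) auto
  also have "\<dots> = h powr p + h powr q" by (simp add: distrib_right hr)
  also have "h powr q \<le> h powr p + 1"
  proof (cases "h \<le> 1")
    case True
    then have "h powr q \<le> 1 powr q" using h assms by (intro powr_mono2) auto
    then show ?thesis by (simp add: add_increasing)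
  next
    case False
    then have "h powr q \<le> h powr p" using assms by (intro powr_mono) auto
    then show ?thesis by simp
  qed
  finally show ?thesis by simp
qed

text \<open>Sum of the Diaz-Saa inequalities with \<open>r = p\<close> and \<open>r = q\<close>.\<close>

lemma pq_flux_diaz_saa:
  fixes X Y :: "'a::euclidean_space"
  assumes "1 < q" "q < p" "0 < U" "0 < V"
  shows "pq_flux p q Y \<bullet> (ds_test_dU q 0 (1 - q) 0 U V *\<^sub>R X + ds_test_dV q 0 (1 - q) 0 U V *\<^sub>R Y)
       \<le> pq_flux p q X \<bullet> (ds_test_dU q (1 - q) 0 0 U V *\<^sub>R X + ds_test_dV q (1 - q) 0 0 U V *\<^sub>R Y)"
  using diaz_saa[of q p U V Y X] diaz_saa[of q q U V Y X] assms
  unfolding pq_flux_def inner_scaleR_left distrib_right by (intro add_mono) auto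

lemma pq_flux_measurable [measurable]: "pq_flux p q \<in> borel_measurable borel"
  unfolding pq_flux_def[abs_def] by measurable

lemma tendsto_ds_test_0_args:
  assumes "(U \<longlongrightarrow> U0) F" "(V \<longlongrightarrow> V0) F" "0 < U0" "0 < V0"
  shows "((\<lambda>n. ds_test q a b 0 (U n) (V n)) \<longlongrightarrow> ds_test q a b 0 U0 V0) F"
  unfolding ds_test_def using assms by (intro tendsto_intros tendsto_soft_pos; simp)

text \<open>The singular part is dominated by a multiple of \<open>z powr (1 - \<delta>)\<close>, as \<open>u \<le> (c2 / c1) z\<close>. The function \<open>z\<close> stands for either of the two
  compared functions, which are both tested against multiples of \<open>u\<close>.\<close>

lemma singular_reaction_integrable:
  assumes \<Omega>: "open \<Omega>" and q: "1 < q" and g: "caratheodory \<Omega> g"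
    and anti: "AE x in lebesgue_on \<Omega>. antimono_on {0<..} (\<lambda>s. g x s / s powr (q - 1))"
    and u [measurable]: "u \<in> borel_measurable (lebesgue_on \<Omega>)" and z [measurable]: "z \<in> borel_measurable (lebesgue_on \<Omega>)"
    and sing: "integrable (lebesgue_on \<Omega>) (\<lambda>x. z x powr (1 - \<delta>))"
    and wpos: "AE x in lebesgue_on \<Omega>. 0 < w x" and c: "0 < c1" "0 < c2"
    and uw: "AE x in lebesgue_on \<Omega>. c1 * w x \<le> u x \<and> u x \<le> c2 * w x"
    and zw: "AE x in lebesgue_on \<Omega>. c1 * w x \<le> z x \<and> z x \<le> c2 * w x"
    and g1: "integrable (lebesgue_on \<Omega>) (\<lambda>x. \<bar>g x (c1 * w x)\<bar> * w x)"
    and g2: "integrable (lebesgue_on \<Omega>) (\<lambda>x. \<bar>g x (c2 * w x)\<bar> * w x)"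
  shows "(\<lambda>x. z x powr (- \<delta>) + g x (z x)) \<in> borel_measurable (lebesgue_on \<Omega>)"
    "integrable (lebesgue_on \<Omega>) (\<lambda>x. (z x powr (- \<delta>) + g x (z x)) * u x)"
proof -
  let ?M = "lebesgue_on \<Omega>"
  have zpos: "AE x in ?M. 0 < z x"
    using zw wpos by eventually_elim (use c in \<open>metis mult_pos_pos order.strict_trans2\<close>)
  have [measurable]: "(\<lambda>x. g x (z x)) \<in> borel_measurable ?M"
    by (rule caratheodory_compose_measurable[OF _ g z zpos]) (use \<Omega> in simp)
  show meas [measurable]: "(\<lambda>x. z x powr (- \<delta>) + g x (z x)) \<in> borel_measurable ?M" by measurable
  define k where "k = (c2 / c1) powr (q - 1)"
  let ?b = "\<lambda>x. c2 / c1 * z x powr (1 - \<delta>) + c2 * (k * (\<bar>g x (c1 * w x)\<bar> * w x) + \<bar>g x (c2 * w x)\<bar> * w x)"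
  show "integrable ?M (\<lambda>x. (z x powr (- \<delta>) + g x (z x)) * u x)"
  proof (rule Bochner_Integration.integrable_bound[of _ ?b])
    show "integrable ?M ?b" using sing g1 g2 by simp
    show "AE x in ?M. norm ((z x powr (- \<delta>) + g x (z x)) * u x) \<le> norm (?b x)"
      using anti uw zw wpos
    proof eventually_elim
      case (elim x)
      have w: "0 < c1 * w x" "0 < c2 * w x" using elim c by auto
      have zp: "0 < z x" and up: "0 < u x" using elim w by linarith+
      have "c1 * u x \<le> c1 * (c2 * w x)" using elim c by simp
      also have "\<dots> \<le> c2 * z x" using elim c by simp
      finally have "u x \<le> c2 / c1 * z x" using c by (simp add: field_simps)
      then have "z x powr (- \<delta>) * u x \<le> z x powr (- \<delta>) * (c2 / c1 * z x)" by (intro mult_left_mono) auto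
      also have "\<dots> = c2 / c1 * z x powr (1 - \<delta>)" using zp powr_add[of "z x" "- \<delta>" 1] by simp
      finally have 1: "z x powr (- \<delta>) * u x \<le> c2 / c1 * z x powr (1 - \<delta>)" .
      have "\<bar>g x (z x)\<bar> \<le> (c2 * w x / (c1 * w x)) powr (q - 1) * \<bar>g x (c1 * w x)\<bar> + \<bar>g x (c2 * w x)\<bar>"
        using elim q w by (intro quotient_antimono_abs_le) auto
      also have "\<dots> = k * \<bar>g x (c1 * w x)\<bar> + \<bar>g x (c2 * w x)\<bar>" using elim by (simp add: k_def)
      finally have "\<bar>g x (z x)\<bar> * u x \<le> (k * \<bar>g x (c1 * w x)\<bar> + \<bar>g x (c2 * w x)\<bar>) * (c2 * w x)"
        using elim up by (intro mult_mono) auto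
      then have 2: "\<bar>g x (z x)\<bar> * u x \<le> c2 * (k * (\<bar>g x (c1 * w x)\<bar> * w x) + \<bar>g x (c2 * w x)\<bar> * w x)"
        by (simp add: algebra_simps)
      have "norm ((z x powr (- \<delta>) + g x (z x)) * u x) \<le> z x powr (- \<delta>) * u x + \<bar>g x (z x)\<bar> * u x"
        using up by (simp add: abs_mult distrib_right[symmetric] mult_right_mono order_trans[OF abs_triangle_ineq])
      then have "norm ((z x powr (- \<delta>) + g x (z x)) * u x) \<le> ?b x" using 1 2 by linarith
      then show ?case by (smt (verit) real_norm_def)
    qed
  qed measurable
qed

section \<open>The comparison principle\<close>

theorem theorem3p6:
  fixes \<Omega> :: "'a::euclidean_space set"
    and p q \<delta> c1 c2 :: real
    and g :: "'a \<Rightarrow> real \<Rightarrow> real"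
    and u v w :: "'a \<Rightarrow> real"
  assumes "DIM('a) \<ge> 2"
    and "open \<Omega>" "connected \<Omega>" "\<Omega> \<noteq> {}" "bounded \<Omega>" "C2_boundary \<Omega>"
    and "1 < q" "q < p" "\<delta> > 0"
    and "caratheodory \<Omega> g"
    and "\<exists>m. \<forall>x\<in>\<Omega>. \<forall>s>0. m \<le> g x s"
    and "AE x in lebesgue_on \<Omega>. antimono_on {0<..} (\<lambda>s. g x s / s powr (q - 1))"
    and "u \<in> Linf_space \<Omega>" "u \<in> W01p p \<Omega>"
    and "v \<in> Linf_space \<Omega>" "v \<in> W01p p \<Omega>"
    and "positive_in \<Omega> u" "positive_in \<Omega> v"
    and "integrable (lebesgue_on \<Omega>) (\<lambda>x. u x powr (1 - \<delta>))"
    and "integrable (lebesgue_on \<Omega>) (\<lambda>x. v x powr (1 - \<delta>))"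
    and "weak_pq_le p q \<Omega> u (\<lambda>x. u x powr (- \<delta>) + g x (u x))"
    and "weak_pq_ge p q \<Omega> v (\<lambda>x. v x powr (- \<delta>) + g x (v x))"
    and "w \<in> Linf_space \<Omega>" "AE x in lebesgue_on \<Omega>. 0 < w x"
    and "c1 > 0" "c2 > 0"
    and "AE x in lebesgue_on \<Omega>. c1 * w x \<le> u x \<and> u x \<le> c2 * w x"
    and "AE x in lebesgue_on \<Omega>. c1 * w x \<le> v x \<and> v x \<le> c2 * w x"
    and "integrable (lebesgue_on \<Omega>) (\<lambda>x. \<bar>g x (c1 * w x)\<bar> * w x)"
    and "integrable (lebesgue_on \<Omega>) (\<lambda>x. \<bar>g x (c2 * w x)\<bar> * w x)"
  shows "AE x in lebesgue_on \<Omega>. u x \<le> v x"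
proof -
  let ?M = "lebesgue_on \<Omega>" and ?Du = "weak_grad \<Omega> u" and ?Dv = "weak_grad \<Omega> v"
  note \<Omega> = \<open>open \<Omega>\<close> \<open>bounded \<Omega>\<close> and pq = \<open>1 < q\<close> \<open>q < p\<close> and c = \<open>c1 > 0\<close> \<open>c2 > 0\<close>
  note wpos = \<open>AE x in ?M. 0 < w x\<close>
  note uw = \<open>AE x in ?M. c1 * w x \<le> u x \<and> u x \<le> c2 * w x\<close>
  note vw = \<open>AE x in ?M. c1 * w x \<le> v x \<and> v x \<le> c2 * w x\<close>
  note anti = \<open>AE x in ?M. antimono_on {0<..} (\<lambda>s. g x s / s powr (q - 1))\<close>
  have p: "1 < p" using pq by simp
  interpret finite_measure ?M using \<Omega> by (rule finite_measure_lebesgue_on_bounded)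
  have [measurable]: "u \<in> borel_measurable ?M" "v \<in> borel_measurable ?M"
    using \<open>u \<in> Linf_space \<Omega>\<close> \<open>v \<in> Linf_space \<Omega>\<close> by (auto simp: Linf_space_def)
  have [measurable]: "?Du \<in> borel_measurable ?M" "?Dv \<in> borel_measurable ?M"
    using \<open>u \<in> W01p p \<Omega>\<close> \<open>v \<in> W01p p \<Omega>\<close> by (auto simp: W01p_def W1p_def Lp_space_def)
  obtain un hu where un: "\<And>n. un n \<in> test_functions \<Omega>"
    "hu \<in> Lp_space p \<Omega>" "\<And>x. 0 \<le> hu x"
    "AE x in ?M. (\<lambda>n. un n x) \<longlonglongrightarrow> u x \<and> (\<lambda>n. grad (un n) x) \<longlonglongrightarrow> ?Du x \<and>
       norm (?Du x) \<le> hu x \<and> (\<forall>n. norm (grad (un n) x) \<le> hu x)"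
    by (rule W01p_dominated_approx[OF \<Omega> p \<open>u \<in> W01p p \<Omega>\<close>]) blast
  obtain vn hv where vn: "\<And>n. vn n \<in> test_functions \<Omega>"
    "hv \<in> Lp_space p \<Omega>" "\<And>x. 0 \<le> hv x"
    "AE x in ?M. (\<lambda>n. vn n x) \<longlonglongrightarrow> v x \<and> (\<lambda>n. grad (vn n) x) \<longlonglongrightarrow> ?Dv x \<and>
       norm (?Dv x) \<le> hv x \<and> (\<forall>n. norm (grad (vn n) x) \<le> hv x)"
    by (rule W01p_dominated_approx[OF \<Omega> p \<open>v \<in> W01p p \<Omega>\<close>]) blast
  define h where "h x = hu x + hv x" for x
  have h: "h \<in> Lp_space p \<Omega>" "\<And>x. 0 \<le> h x" "\<And>x. hu x \<le> h x" "\<And>x. hv x \<le> h x"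
    using Lp_space_add[OF _ un(2) vn(2)] un(3) vn(3) p by (auto simp: h_def[abs_def])
  from Linf_space_AE_bound[OF \<open>u \<in> Linf_space \<Omega>\<close>] obtain Ru where Ru: "AE x in ?M. \<bar>u x\<bar> < Ru" .
  from Linf_space_AE_bound[OF \<open>v \<in> Linf_space \<Omega>\<close>] obtain Rv where Rv: "AE x in ?M. \<bar>v x\<bar> < Rv" .
  define R where "R = max 0 (max Ru Rv)"
  interpret approximated_pair \<Omega> u v ?Du ?Dv un vn h R
  proof
    show "AE x in ?M. 0 < u x \<and> u x < R \<and> 0 < v x \<and> v x < R"
      using wpos uw vw Ru Rv
    proof eventually_elim
      case (elim x)
      then have "0 < c1 * w x" using c by simp
      then show ?case using elim by (auto simp: R_def)
    qed
    show "AE x in ?M. (\<lambda>n. un n x) \<longlonglongrightarrow> u x \<and> (\<lambda>n. grad (un n) x) \<longlonglongrightarrow> ?Du x \<and>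
       norm (?Du x) \<le> h x \<and> (\<forall>n. norm (grad (un n) x) \<le> h x)"
      using un(4) by eventually_elim (meson h(3) order_trans)
    show "AE x in ?M. (\<lambda>n. vn n x) \<longlonglongrightarrow> v x \<and> (\<lambda>n. grad (vn n) x) \<longlonglongrightarrow> ?Dv x \<and>
       norm (?Dv x) \<le> h x \<and> (\<forall>n. norm (grad (vn n) x) \<le> h x)"
      using vn(4) by eventually_elim (meson h(4) order_trans)
    show "compact K \<Longrightarrow> K \<subseteq> \<Omega> \<Longrightarrow> \<exists>c>0. AE x in ?M. x \<in> K \<longrightarrow> c \<le> u x" for K
      using positive_in_compact_lower_bound[OF \<open>positive_in \<Omega> u\<close> _ _ \<open>open \<Omega>\<close>] .
  qed (use \<Omega> un vn in \<open>auto simp: R_def\<close>)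
  define fu where "fu x = u x powr (- \<delta>) + g x (u x)" for x
  define fv where "fv x = v x powr (- \<delta>) + g x (v x)" for x
  have fu [measurable]: "fu \<in> borel_measurable ?M" and fuu: "integrable ?M (\<lambda>x. fu x * u x)"
    unfolding fu_def[abs_def]
    by (rule singular_reaction_integrable[OF \<open>open \<Omega>\<close> \<open>1 < q\<close> \<open>caratheodory \<Omega> g\<close> anti _ _ _ wpos c uw uw]; use assms in measurable)+
  have fv [measurable]: "fv \<in> borel_measurable ?M" and fvu: "integrable ?M (\<lambda>x. fv x * u x)"
    unfolding fv_def[abs_def]
    by (rule singular_reaction_integrable[OF \<open>open \<Omega>\<close> \<open>1 < q\<close> \<open>caratheodory \<Omega> g\<close> anti _ _ _ wpos c uw vw]; use assms in measurable)+
  define Au where "Au x = pq_flux p q (?Du x)" for x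
  define Av where "Av x = pq_flux p q (?Dv x)" for x
  have [measurable]: "Au \<in> borel_measurable ?M" "Av \<in> borel_measurable ?M" "h \<in> borel_measurable ?M"
    using h(1) unfolding Au_def[abs_def] Av_def[abs_def] by (auto simp: Lp_space_def)
  have hint: "integrable ?M (\<lambda>x. 2 * h x powr p + 1)"
    using h(1,2) by (auto simp: Lp_space_def)
  have Ah: "integrable ?M (\<lambda>x. norm (Au x) * h x)" "integrable ?M (\<lambda>x. norm (Av x) * h x)"
  proof -
    have bound: "AE x in ?M. norm (norm (Au x) * h x) \<le> norm (2 * h x powr p + 1)"
      "AE x in ?M. norm (norm (Av x) * h x) \<le> norm (2 * h x powr p + 1)"
      using AE_regular_point
      by (eventually_elim, use h(2) in \<open>simp add: Au_def Av_def regular_point_def pq_flux_mult_le[OF pq]\<close>)+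
    show "integrable ?M (\<lambda>x. norm (Au x) * h x)" "integrable ?M (\<lambda>x. norm (Av x) * h x)"
      by (rule Bochner_Integration.integrable_bound[OF hint _ bound(1)] 
          Bochner_Integration.integrable_bound[OF hint _ bound(2)]; measurable)+
  qed

  define Gu where "Gu \<epsilon> x = ds_test_dU q (1 - q) 0 0 (u x + \<epsilon>) (v x + \<epsilon>) *\<^sub>R ?Du x + ds_test_dV q (1 - q) 0 0 (u x + \<epsilon>) (v x + \<epsilon>) *\<^sub>R ?Dv x" for \<epsilon> x
  define Gv where "Gv \<epsilon> x = ds_test_dU q 0 (1 - q) 0 (u x + \<epsilon>) (v x + \<epsilon>) *\<^sub>R ?Du x + ds_test_dV q 0 (1 - q) 0 (u x + \<epsilon>) (v x + \<epsilon>) *\<^sub>R ?Dv x" for \<epsilon> x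
  define Lu where "Lu \<epsilon> x = ds_test q (1 - q) 0 0 (u x + \<epsilon>) (v x + \<epsilon>)" for \<epsilon> x
  define Lv where "Lv \<epsilon> x = ds_test q 0 (1 - q) 0 (u x + \<epsilon>) (v x + \<epsilon>)" for \<epsilon> x
  have [measurable]: "Gu \<epsilon> \<in> borel_measurable ?M" "Gv \<epsilon> \<in> borel_measurable ?M" "Lu \<epsilon> \<in> borel_measurable ?M" "Lv \<epsilon> \<in> borel_measurable ?M" for \<epsilon>
    unfolding Gu_def[abs_def] Gv_def[abs_def] Lu_def[abs_def] Lv_def[abs_def] by measurable

  \<comment> \<open>Both inequalities tested, the one for \<open>v\<close> with all signs reversed.\<close>
  have tested_u: "(LINT x|?M. Au x \<bullet> Gu \<epsilon> x) \<le> (LINT x|?M. fu x * Lu \<epsilon> x)" if "0 < \<epsilon>" for \<epsilon>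
    unfolding Gu_def Lu_def
  proof (rule weak_inequality_ds_test[OF pq(1) that _ Ah(1) _ fuu])
    fix \<phi> :: "'a \<Rightarrow> real" assume "\<phi> \<in> test_functions \<Omega>" "\<And>x. 0 \<le> \<phi> x"
    then show "(LINT x|?M. Au x \<bullet> grad \<phi> x) \<le> (LINT x|?M. fu x * \<phi> x)"
      using \<open>weak_pq_le p q \<Omega> u _\<close> by (simp add: weak_pq_le_def pq_laplace_form_flux Au_def fu_def)
  qed measurable
  have tested_v: "(LINT x|?M. fv x * Lv \<epsilon> x) \<le> (LINT x|?M. Av x \<bullet> Gv \<epsilon> x)" if "0 < \<epsilon>" for \<epsilon>
  proof -
    have "(LINT x|?M. (- Av x) \<bullet> Gv \<epsilon> x) \<le> (LINT x|?M. (- fv x) * Lv \<epsilon> x)"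
      unfolding Gv_def Lv_def
    proof (rule weak_inequality_ds_test[OF pq(1) that])
      fix \<phi> :: "'a \<Rightarrow> real" assume "\<phi> \<in> test_functions \<Omega>" "\<And>x. 0 \<le> \<phi> x"
      then have "(LINT x|?M. fv x * \<phi> x) \<le> (LINT x|?M. Av x \<bullet> grad \<phi> x)"
        using \<open>weak_pq_ge p q \<Omega> v _\<close> by (simp add: weak_pq_ge_def pq_laplace_form_flux Av_def fv_def)
      then show "(LINT x|?M. (- Av x) \<bullet> grad \<phi> x) \<le> (LINT x|?M. (- fv x) * \<phi> x)" by simp
    qed (use Ah(2) fvu in simp_all)
    then show ?thesis by simp
  qed
  have flux_int: "integrable ?M (\<lambda>x. Au x \<bullet> Gu \<epsilon> x)" "integrable ?M (\<lambda>x. Av x \<bullet> Gv \<epsilon> x)" if "0 < \<epsilon>" for \<epsilon>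
    unfolding Gu_def Gv_def by (rule integrable_inner_ds_test_grad[OF that]; (rule Ah | measurable))+
  have diff_nonneg: "0 \<le> (LINT x|?M. fu x * Lu \<epsilon> x) - (LINT x|?M. fv x * Lv \<epsilon> x)" if \<epsilon>: "0 < \<epsilon>" for \<epsilon>
  proof -
    have "(LINT x|?M. Av x \<bullet> Gv \<epsilon> x) \<le> (LINT x|?M. Au x \<bullet> Gu \<epsilon> x)"
    proof (rule integral_mono_AE[OF flux_int(2)[OF \<epsilon>] flux_int(1)[OF \<epsilon>]])
      show "AE x in ?M. Av x \<bullet> Gv \<epsilon> x \<le> Au x \<bullet> Gu \<epsilon> x"
        using AE_regular_point
      proof eventually_elim
        case (elim x)
        then show ?case unfolding Au_def Av_def Gu_def Gv_def using \<epsilon> pq 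
          by (intro pq_flux_diaz_saa) (auto simp: regular_point_def)
      qed
    qed
    then show ?thesis using tested_u[OF \<epsilon>] tested_v[OF \<epsilon>] by linarith
  qed

  define k where "k = (c2 / c1) powr (q - 1)"
  \<comment> \<open>Bounds uniform in \<open>\<epsilon>\<close>: in \<open>Lv\<close> the powers of \<open>U\<close> and \<open>V\<close> do not cancel, but \<open>U / V \<le> c2 / c1\<close>
     because \<open>u \<le> (c2 / c1) v\<close> and \<open>\<epsilon> \<le> (c2 / c1) \<epsilon>\<close>.\<close>
  have Lu_le: "\<bar>Lu \<epsilon> x\<bar> \<le> q * u x" if "regular_point x" "0 \<le> \<epsilon>" for \<epsilon> x
  proof -
    have UV: "0 < u x + \<epsilon>" "0 < v x + \<epsilon>" using that by (auto simp: regular_point_def)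
    have "\<bar>Lu \<epsilon> x\<bar> \<le> q * ((u x + \<epsilon>) powr (1 - q) * (u x + \<epsilon>) powr (q - 1)) * max (u x - v x) 0"
      using ds_test_le_diff[OF pq(1) UV, of "1 - q" 0] UV by (simp add: Lu_def ds_test_nonneg mult_ac)
    also have "(u x + \<epsilon>) powr (1 - q) * (u x + \<epsilon>) powr (q - 1) = 1"
      using UV by (simp flip: powr_add)
    finally have "\<bar>Lu \<epsilon> x\<bar> \<le> q * max (u x - v x) 0" by simp
    also have "\<dots> \<le> q * u x" using that pq by (intro mult_left_mono) (auto simp: regular_point_def)
    finally show ?thesis .
  qed
  have Lv_le: "\<bar>Lv \<epsilon> x\<bar> \<le> q * k * u x" if "regular_point x" "0 \<le> \<epsilon>" "u x \<le> c2 / c1 * v x" "c1 \<le> c2" for \<epsilon> x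
  proof -
    have UV: "0 < u x + \<epsilon>" "0 < v x + \<epsilon>" using that by (auto simp: regular_point_def)
    have "\<epsilon> * 1 \<le> \<epsilon> * (c2 / c1)" using that c by (intro mult_left_mono) auto
    then have "u x + \<epsilon> \<le> c2 / c1 * (v x + \<epsilon>)" using that(3) by (simp add: distrib_left mult.commute)
    then have "((u x + \<epsilon>) / (v x + \<epsilon>)) powr (q - 1) \<le> k"
      unfolding k_def using UV pq by (intro powr_mono2) (auto simp: divide_le_eq)
    also have "((u x + \<epsilon>) / (v x + \<epsilon>)) powr (q - 1) = (v x + \<epsilon>) powr (1 - q) * (u x + \<epsilon>) powr (q - 1)"
      using UV powr_minus_divide[of "v x + \<epsilon>" "q - 1"] by (simp add: powr_divide)
    finally have *: "(v x + \<epsilon>) powr (1 - q) * (u x + \<epsilon>) powr (q - 1) \<le> k" .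
    have "\<bar>Lv \<epsilon> x\<bar> \<le> q * ((v x + \<epsilon>) powr (1 - q) * (u x + \<epsilon>) powr (q - 1)) * max (u x - v x) 0"
      using ds_test_le_diff[OF pq(1) UV, of 0 "1 - q"] UV by (simp add: Lv_def ds_test_nonneg mult_ac)
    also have "\<dots> \<le> q * k * u x"
      using that pq * by (intro mult_mono) (auto simp: regular_point_def k_def)
    finally show ?thesis .
  qed
  have ratio: "AE x in ?M. u x \<le> c2 / c1 * v x \<and> c1 \<le> c2"
    using uw vw wpos
  proof eventually_elim
    case (elim x)
    have "c1 * w x \<le> c2 * w x" using elim by linarith
    then have "c1 \<le> c2" using elim by simp
    have "c1 * u x \<le> c1 * (c2 * w x)" using elim c by simp
    also have "\<dots> \<le> c2 * v x" using elim c by simp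
    finally show ?case using c \<open>c1 \<le> c2\<close> by (simp add: field_simps)
  qed
  have t: "(\<lambda>n. 1 / real (Suc n)) \<longlonglongrightarrow> 0" using LIMSEQ_Suc[OF lim_const_over_n[of 1]] by simp
  have lim: "integrable ?M (\<lambda>x. f x * L 0 x)" 
    "(\<lambda>n. LINT x|?M. f x * L (1 / Suc n) x) \<longlonglongrightarrow> (LINT x|?M. f x * L 0 x)"
    if [measurable]: "f \<in> borel_measurable ?M" "\<And>\<epsilon>. L \<epsilon> \<in> borel_measurable ?M" and fu: "integrable ?M (\<lambda>x. f x * u x)"
      and le: "AE x in ?M. \<forall>\<epsilon>\<ge>0. \<bar>L \<epsilon> x\<bar> \<le> C * u x" 
      and L: "AE x in ?M. (\<lambda>n. L (1 / Suc n) x) \<longlonglongrightarrow> L 0 x" for f C and L :: "real \<Rightarrow> 'a \<Rightarrow> real"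
  proof -
    have dom: "integrable ?M (\<lambda>x. \<bar>C * (f x * u x)\<bar>)" using fu by simp
    have lims: "AE x in ?M. (\<lambda>n. f x * L (1 / Suc n) x) \<longlonglongrightarrow> f x * L 0 x"
      using L by eventually_elim (intro tendsto_intros)
    have bound: "AE x in ?M. norm (f x * L (1 / Suc n) x) \<le> \<bar>C * (f x * u x)\<bar>" for n
      using le
    proof eventually_elim
      case (elim x)
      then have "\<bar>f x\<bar> * \<bar>L (1 / Suc n) x\<bar> \<le> \<bar>f x\<bar> * \<bar>C * u x\<bar>"
        by (intro mult_left_mono) (auto intro: order_trans[OF _ abs_ge_self])
      then show ?case by (simp add: abs_mult mult_ac)
    qed
    show "integrable ?M (\<lambda>x. f x * L 0 x)" 
      by (rule integrable_dominated_convergence[OF _ _ dom lims bound]) measurable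
    show "(\<lambda>n. LINT x|?M. f x * L (1 / Suc n) x) \<longlonglongrightarrow> (LINT x|?M. f x * L 0 x)"
      by (rule integral_dominated_convergence[OF _ _ dom lims bound]) measurable
  qed
  have conv: "AE x in ?M. (\<lambda>n. ds_test q a b 0 (u x + 1 / Suc n) (v x + 1 / Suc n)) \<longlonglongrightarrow> ds_test q a b 0 (u x + 0) (v x + 0)" for a b
    using AE_regular_point by eventually_elim (intro tendsto_ds_test_0_args tendsto_intros t; simp add: regular_point_def)
  have le: "AE x in ?M. \<forall>\<epsilon>\<ge>0. \<bar>Lu \<epsilon> x\<bar> \<le> q * u x" "AE x in ?M. \<forall>\<epsilon>\<ge>0. \<bar>Lv \<epsilon> x\<bar> \<le> q * k * u x"
    using AE_regular_point ratio by (eventually_elim, use Lu_le Lv_le in blast)+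
  have convs: "AE x in ?M. (\<lambda>n. Lu (1 / Suc n) x) \<longlonglongrightarrow> Lu 0 x" "AE x in ?M. (\<lambda>n. Lv (1 / Suc n) x) \<longlonglongrightarrow> Lv 0 x"
    unfolding Lu_def Lv_def by (rule conv)+
  have lim_u: "integrable ?M (\<lambda>x. fu x * Lu 0 x)" 
    "(\<lambda>n. LINT x|?M. fu x * Lu (1 / Suc n) x) \<longlonglongrightarrow> (LINT x|?M. fu x * Lu 0 x)"
    by (rule lim[OF _ _ fuu le(1) convs(1)]; measurable)+
  have lim_v: "integrable ?M (\<lambda>x. fv x * Lv 0 x)" 
    "(\<lambda>n. LINT x|?M. fv x * Lv (1 / Suc n) x) \<longlonglongrightarrow> (LINT x|?M. fv x * Lv 0 x)"
    by (rule lim[OF _ _ fvu le(2) convs(2)]; measurable)+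
  have "0 \<le> (LINT x|?M. fu x * Lu 0 x) - (LINT x|?M. fv x * Lv 0 x)"
    by (rule LIMSEQ_le_const[OF tendsto_diff[OF lim_u(2) lim_v(2)]]) (use diff_nonneg in auto)
  then have le0: "(LINT x|?M. fv x * Lv 0 x - fu x * Lu 0 x) \<le> 0"
    using lim_u(1) lim_v(1) by simp
  \<comment> \<open>The sign of the limit integrand, and what follows where it vanishes.\<close>
  have pt: "AE x in ?M. 0 \<le> fv x * Lv 0 x - fu x * Lu 0 x \<and> (fv x * Lv 0 x - fu x * Lu 0 x = 0 \<longrightarrow> u x \<le> v x)"
    using AE_regular_point anti
  proof eventually_elim
    case (elim x)
    then have pos: "0 < u x" "0 < v x" by (auto simp: regular_point_def)
    show ?case
    proof (cases "v x < u x")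
      case True
      define z where "z = u x powr q - v x powr q"
      have z: "0 < z" unfolding z_def using True pos pq by (simp add: powr_less_mono2)
      have "fv x * Lv 0 x - fu x * Lu 0 x = z * (fv x * v x powr (1 - q) - fu x * u x powr (1 - q))"
        using z pos by (simp add: Lu_def Lv_def ds_test_def soft_pos_0 z_def[symmetric] algebra_simps)
      moreover have "fu x * u x powr (1 - q) < fv x * v x powr (1 - q)"
        unfolding fu_def fv_def
        by (rule singular_reaction_quotient_less[OF elim(2) pq(1) \<open>\<delta> > 0\<close> pos(2) True])
      ultimately show ?thesis using z by simp
    next
      case False
      then have "u x powr q \<le> v x powr q" using pos pq by (intro powr_mono2) auto
      then show ?thesis using False by (simp add: Lu_def Lv_def ds_test_def soft_pos_0)
    qed
  qed
  have int: "integrable ?M (\<lambda>x. fv x * Lv 0 x - fu x * Lu 0 x)" using lim_u lim_v by simp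
  have nn: "AE x in ?M. 0 \<le> fv x * Lv 0 x - fu x * Lu 0 x" using pt by eventually_elim simp
  have "(LINT x|?M. fv x * Lv 0 x - fu x * Lu 0 x) = 0"
    using le0 integral_nonneg_AE[OF nn] by linarith
  then have "AE x in ?M. fv x * Lv 0 x - fu x * Lu 0 x = 0"
    using integral_nonneg_eq_0_iff_AE[OF int nn] by simp
  with pt show ?thesis by eventually_elim blast
qed

end
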